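(* For $\epsilon>0$ consider the system $$x' = \cos y+\epsilon\sin z,\qquad y' = \sin x+\epsilon\cos z,\qquad z' = \cos x+\sin y. \qquad ( * )$$ For all small enough $\epsilon>0$ the following hold. (a) There exist $T>0$ and four trajectories $X(t)$ of $( * )$ that satisfy, respectively, for all $t\in\mathbb{R}$, $$X(t+T)=X(t)+(2\pi,2\pi,0),$$ $$X(t+T)=X(t)-(2\pi,2\pi,0),$$ $$X(t+T)=X(t)+(2\pi,-2\pi,0),$$ $$X(t+T)=X(t)-(2\pi,-2\pi,0).$$ (b) There exist $T>0$ and four trajectories $X(t)$ of $( * )$ that satisfy, respectively, for all $t\in\mathbb{R}$, $$X(t+T)=X(t)+(2\pi,0,0),$$ $$X(t+T)=X(t)-(2\pi,0,0),$$ $$X(t+T)=X(t)+(0,2\pi,0),$$ $$X(t+T)=X(t)-(0,2\pi,0).$$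
   Context: The system $( * )$ is the ABC flow with parameters $A=\epsilon$, $B=C=1$; $'$ denotes $d/dt$. A trajectory is a solution $X(t)=(x(t),y(t),z(t))\in\mathbb{R}^3$, $t\in\mathbb{R}$. The number $T$ may depend on $\epsilon$; within each part the same $T$ serves for all four trajectories. *)

theory Defs
  imports "HOL-Analysis.Analysis"
begin

definition abc_field :: "real \<Rightarrow> real \<Rightarrow> real \<Rightarrow> real^3 \<Rightarrow> real^3" where
  "abc_field A B C p = vector
     [A * sin (p$3) + C * cos (p$2),
      B * sin (p$1) + A * cos (p$3),
      C * sin (p$2) + B * cos (p$1)]"

definition abc_trajectory :: "real \<Rightarrow> real \<Rightarrow> real \<Rightarrow> (real \<Rightarrow> real^3) \<Rightarrow> bool" where
  "abc_trajectory A B C X \<longleftrightarrow>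
     (\<forall>t. (X has_vector_derivative abc_field A B C (X t)) (at t))"

end

theory Submission
  imports Defs
begin

text \<open>For \<open>\<epsilon> = 0\<close> the energy \<open>H = sin y + cos x = z'\<close> is conserved and the level \<open>H = 0\<close> is a square net
  of heteroclinic segments joining the saddles \<open>(0, - \<pi> / 2)\<close> and \<open>(\<pi>, \<pi> / 2)\<close> modulo \<open>2 \<pi>\<close>. For small
  \<open>\<epsilon>\<close> a trajectory follows this net, turning at each saddle to a side decided by the sign of \<open>H\<close>, while
  \<open>z\<close> stays nearly constant and \<open>H - \<epsilon> (x cos z - y sin z)\<close> varies by \<open>o(\<epsilon>)\<close> only.

  The reversing symmetry \<open>(\<pi> - x, 2 \<pi> - y, z)\<close> fixes the line \<open>x = \<pi> / 2, y = \<pi>\<close>, which contains the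
  midpoint of a segment. A trajectory that starts on the fixed line of another reversing symmetry and
  hits this line is invariant under the composition of the two, which is a translation up to a
  symmetry of order two. The starting line is \<open>x + y = \<pi> / 2, z = \<pi> / 4\<close> (start near the midpoint
  \<open>(\<pi> / 2, 0)\<close>) for the shift \<open>(2 \<pi>, 2 \<pi>, 0)\<close> and \<open>y = \<pi> / 2, z = 0\<close> (start near the saddle
  \<open>(\<pi>, \<pi> / 2)\<close>) for the shift \<open>(0, 2 \<pi>, 0)\<close>. On each line the position is parametrized by
  \<open>h = H / \<epsilon>\<close> at time \<open>0\<close>; every trajectory of the family reaches \<open>y = \<pi>\<close> within time \<open>O(\<epsilon> powr (-1/2))\<close>
  with \<open>y' > 0\<close>, the sign of \<open>x - \<pi> / 2\<close> there changes with \<open>h\<close>, and the intermediate value theorem gives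
  a hit. The remaining shifts come from further symmetries.\<close>

section \<open>Globally Lipschitz differential equations\<close>

lemma antiderivative_zero_at_0:
  fixes f :: "real \<Rightarrow> 'a::euclidean_space"
  assumes "continuous_on UNIV f"
  shows "\<exists>G. G 0 = 0 \<and> (\<forall>t. (G has_vector_derivative f t) (at t))"
proof -
  have "isCont f x" for x
    using assms by (simp add: continuous_on_eq_continuous_at)
  then obtain G where G: "\<And>x. (G has_vector_derivative f x) (at x)"
    using einterval_antiderivative[of "-\<infinity>" "\<infinity>" f] by auto
  have "((\<lambda>t. G t - G 0) has_vector_derivative f x) (at x)" for x
    by (auto intro!: derivative_eq_intros G)
  then show ?thesis
    by (intro exI[of _ "\<lambda>t. G t - G 0"]) auto
qed

lemma has_vector_derivative_reflect:
  fixes X :: "real \<Rightarrow> 'a::real_normed_vector"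
  assumes "(X has_vector_derivative D) (at (- s))"
  shows "((\<lambda>t. X (- t)) has_vector_derivative - D) (at s)"
proof -
  have "(uminus has_vector_derivative (- 1 :: real)) (at s)"
    by (auto intro!: derivative_eq_intros)
  from vector_diff_chain_at[OF this assms] show ?thesis
    by (simp add: o_def)
qed

text \<open>For positive times \<open>K / k * exp (k * t)\<close> has derivative
  \<open>K * exp (k * t)\<close> and so dominates the growth of \<open>G\<close>; negative times
  follow by reflecting the curve. This is the estimate that makes the exponentially weighted norm
  work in Picard's argument.\<close>

lemma norm_antiderivative_le_exp:
  fixes f :: "real \<Rightarrow> 'a::real_normed_vector"
  assumes G: "\<And>t. (G has_vector_derivative f t) (at t)" "G 0 = 0"
    and f: "\<And>t. norm (f t) \<le> K * exp (k * \<bar>t\<bar>)" and k: "k > 0"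
  shows "norm (G t) \<le> K / k * (exp (k * \<bar>t\<bar>) - 1)"
proof -
  have pos: "norm (G t) \<le> K / k * (exp (k * t) - 1)"
    if "t > 0" "\<And>t. (G has_vector_derivative f t) (at t)" "G 0 = 0"
      "\<And>t. norm (f t) \<le> K * exp (k * \<bar>t\<bar>)"
    for G f and t :: real
  proof -
    have "norm (G t - G 0) \<le> K / k * exp (k * t) - K / k * exp (k * 0)"
    proof (rule differentiable_bound_general[where f' = f and \<phi>' = "\<lambda>t. K * exp (k * t)"])
      show "continuous_on {0..t} G"
        using that(2) by (meson continuous_at_imp_continuous_on has_vector_derivative_continuous)
      show "((\<lambda>t. K / k * exp (k * t)) has_vector_derivative K * exp (k * x)) (at x)" for x
        unfolding has_real_derivative_iff_has_vector_derivative[symmetric]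
        using k by (auto intro!: derivative_eq_intros)
      show "norm (f x) \<le> K * exp (k * x)" if "0 < x" for x
        using \<open>\<And>t. norm (f t) \<le> K * exp (k * \<bar>t\<bar>)\<close>[of x] that by simp
    qed (use that k in \<open>auto intro!: continuous_intros\<close>)
    then show ?thesis
      using that by (simp add: algebra_simps)
  qed
  consider "t > 0" | "t = 0" | "t < 0" by linarith
  then show ?thesis
  proof cases
    case 1
    then show ?thesis using pos[of t G f] assms by simp
  next
    case 2
    then show ?thesis using assms by simp
  next
    case 3
    have "((\<lambda>t. G (- t)) has_vector_derivative - f (- s)) (at s)" for s
      by (rule has_vector_derivative_reflect[OF G(1)])
    moreover have "norm (- f (- s)) \<le> K * exp (k * \<bar>s\<bar>)" for s
      using f[of "- s"] by simp
    ultimately show ?thesis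
      using 3 pos[of "- t" "\<lambda>t. G (- t)" "\<lambda>s. - f (- s)"] assms by simp
  qed
qed

text \<open>Picard's integral operator is a contraction on all of \<open>\<real>\<close> at once in the supremum norm
  weighted with \<open>exp (- k \<bar>t\<bar>)\<close>, where \<open>k > 2 * L\<close>; an element \<open>g\<close> of the function space below stands
  for the curve \<open>exp (k \<bar>t\<bar>) * g t\<close>.\<close>

lemma lipschitz_ode_solution_exists:
  fixes F :: "'a::euclidean_space \<Rightarrow> 'a"
  assumes lip: "L-lipschitz_on UNIV F" and bdd: "bounded (range F)"
  shows "\<exists>X. X 0 = p \<and> (\<forall>t. (X has_vector_derivative F (X t)) (at t))"
proof -
  have L: "L \<ge> 0" using lip by (rule lipschitz_on_nonneg)
  \<comment> \<open>The contraction factor below is \<open>L / k\<close>, hence at most 1/2; the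
    summand 1 keeps \<open>k\<close> positive when \<open>L\<close> is 0.\<close>
  define k where "k = 2 * L + 1"
  have k: "k > 0" using L by (simp add: k_def)
  obtain B where B: "\<And>x. norm (F x) \<le> B"
    using bdd by (auto simp: bounded_iff)
  then have B0: "B \<ge> 0"
    using norm_ge_zero order_trans by blast
  have contF: "continuous_on UNIV F"
    using lip by (rule lipschitz_on_continuous_on)
  define curve where "curve = (\<lambda>(g :: real \<Rightarrow>\<^sub>C 'a) t. exp (k * \<bar>t\<bar>) *\<^sub>R apply_bcontfun g t)"
  have cont_curve: "continuous_on UNIV (curve g)" for g
    unfolding curve_def by (intro continuous_intros) auto
  have cont_Fc: "continuous_on UNIV (\<lambda>t. F (curve g t))" for g
    by (rule continuous_on_compose2[OF contF cont_curve]) auto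
  define J where
    "J g = (SOME G. G 0 = 0 \<and> (\<forall>t. (G has_vector_derivative F (curve g t)) (at t)))" for g
  have J: "J g 0 = 0" "\<And>t. (J g has_vector_derivative F (curve g t)) (at t)" for g
    using someI_ex[OF antiderivative_zero_at_0[OF cont_Fc[of g]]] by (auto simp: J_def)
  \<comment> \<open>Picard's operator sends \<open>curve g\<close> to \<open>p + J g\<close>;
    \<open>\<Phi>\<close> divides the result by the weight, to land again in the bounded continuous
    functions.\<close>
  define \<Phi> where "\<Phi> g t = exp (- k * \<bar>t\<bar>) *\<^sub>R (p + J g t)" for g t
  have cont_J: "continuous_on UNIV (J g)" for g
    using J(2) by (meson continuous_at_imp_continuous_on has_vector_derivative_continuous)
  have \<Phi>_in: "\<Phi> g \<in> bcontfun" for g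
  proof (rule bcontfun_normI)
    show "continuous_on UNIV (\<Phi> g)"
      unfolding \<Phi>_def using cont_J by (auto intro!: continuous_intros)
    fix t
    have "norm (F (curve g t)) \<le> B * exp (k * \<bar>t\<bar>)" for t
    proof -
      have "B * 1 \<le> B * exp (k * \<bar>t\<bar>)"
        using B0 k by (intro mult_left_mono) auto
      then show ?thesis using B[of "curve g t"] by simp
    qed
    then have "norm (J g t) \<le> B / k * (exp (k * \<bar>t\<bar>) - 1)"
      by (rule norm_antiderivative_le_exp[OF J(2) J(1) _ k])
    also have "\<dots> \<le> B / k * exp (k * \<bar>t\<bar>)"
      using B0 k by (intro mult_left_mono) auto
    finally have "norm (J g t) \<le> B / k * exp (k * \<bar>t\<bar>)" .
    moreover have "norm p \<le> norm p * exp (k * \<bar>t\<bar>)"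
      using k by (simp add: mult_le_cancel_left1)
    ultimately have "norm (p + J g t) \<le> (norm p + B / k) * exp (k * \<bar>t\<bar>)"
      using norm_triangle_ineq[of p "J g t"] by (simp add: algebra_simps)
    then have "exp (- k * \<bar>t\<bar>) * norm (p + J g t)
        \<le> exp (- k * \<bar>t\<bar>) * ((norm p + B / k) * exp (k * \<bar>t\<bar>))"
      by (intro mult_left_mono) auto
    also have "\<dots> = norm p + B / k"
      by (simp add: exp_minus field_simps)
    finally show "norm (\<Phi> g t) \<le> norm p + B / k"
      by (simp add: \<Phi>_def)
  qed
  define T where "T g = Bcontfun (\<Phi> g)" for g
  have T: "apply_bcontfun (T g) = \<Phi> g" for g
    using \<Phi>_in by (simp add: T_def Bcontfun_inverse)
  have "dist (T g) (T h) \<le> 1 / 2 * dist g h" for g h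
  proof (rule dist_bound)
    fix t
    have "norm (F (curve g s) - F (curve h s)) \<le> L * dist g h * exp (k * \<bar>s\<bar>)" for s
    proof -
      have "norm (F (curve g s) - F (curve h s)) \<le> L * norm (curve g s - curve h s)"
        using lipschitz_onD[OF lip] by (simp add: dist_norm)
      also have "norm (curve g s - curve h s) = exp (k * \<bar>s\<bar>) * dist (g s) (h s)"
        by (simp add: curve_def dist_norm flip: scaleR_diff_right)
      also have "L * \<dots> \<le> L * (exp (k * \<bar>s\<bar>) * dist g h)"
        using L by (intro mult_left_mono dist_bounded) auto
      finally show ?thesis by (simp add: mult_ac)
    qed
    then have "norm (J g t - J h t) \<le> L * dist g h / k * (exp (k * \<bar>t\<bar>) - 1)"
      by (intro norm_antiderivative_le_exp[where f = "\<lambda>s. F (curve g s) - F (curve h s)"] k)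
        (auto intro!: derivative_eq_intros J simp: J)
    also have "\<dots> \<le> L * dist g h / k * exp (k * \<bar>t\<bar>)"
      using L k by (intro mult_left_mono) auto
    finally have "exp (- k * \<bar>t\<bar>) * norm (J g t - J h t)
        \<le> exp (- k * \<bar>t\<bar>) * (L * dist g h / k * exp (k * \<bar>t\<bar>))"
      by (intro mult_left_mono) auto
    also have "\<dots> = L / k * dist g h"
      by (simp add: exp_minus field_simps)
    also have "\<dots> \<le> 1 / 2 * dist g h"
      using L by (intro mult_right_mono) (auto simp: k_def field_simps)
    finally show "dist (T g t) (T h t) \<le> 1 / 2 * dist g h"
      by (simp add: T \<Phi>_def dist_norm flip: scaleR_diff_right)
  qed
  then obtain g where g: "T g = g"
    using banach_fix_type[of "1 / 2" T] by auto
  \<comment> \<open>Multiplying the fixed point equation by the weight gives the integral equation,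
    which is then differentiated.\<close>
  have "curve g t = p + J g t" for t
  proof -
    have "curve g t = exp (k * \<bar>t\<bar>) *\<^sub>R \<Phi> g t"
      unfolding curve_def using T[of g] g by simp
    then show ?thesis
      by (simp add: \<Phi>_def flip: exp_add)
  qed
  then have *: "curve g = (\<lambda>t. p + J g t)" by blast
  have "(curve g has_vector_derivative F (curve g t)) (at t)" for t
    by (subst *) (auto intro!: derivative_eq_intros J)
  moreover have "curve g 0 = p"
    using * J by simp
  ultimately show ?thesis by blast
qed

text \<open>Gronwall's argument for the squared distance, which is differentiable even where the
  solutions meet: its derivative \<open>2 * (d \<bullet> d')\<close> is at most
  \<open>2 * L * (d \<bullet> d)\<close>, so multiplied by \<open>exp (- 2 * L * t)\<close> it does
  not increase. Negative times use the reflected curves, which solve the equation for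
  \<open>- F\<close>.\<close>

lemma lipschitz_ode_dependence:
  fixes F :: "'a::real_inner \<Rightarrow> 'a"
  assumes lip: "L-lipschitz_on UNIV F"
    and X: "\<And>t. (X has_vector_derivative F (X t)) (at t)"
    and Y: "\<And>t. (Y has_vector_derivative F (Y t)) (at t)"
  shows "norm (X t - Y t) \<le> exp (L * \<bar>t\<bar>) * norm (X 0 - Y 0)"
proof -
  have pos: "norm (X t - Y t) \<le> exp (L * t) * norm (X 0 - Y 0)"
    if "t \<ge> 0" and lip: "L-lipschitz_on UNIV F"
      and X: "\<And>t. (X has_vector_derivative F (X t)) (at t)"
      and Y: "\<And>t. (Y has_vector_derivative F (Y t)) (at t)"
    for t :: real and F :: "'a \<Rightarrow> 'a" and X Y
  proof -
    define D where "D t = (X t - Y t) \<bullet> (X t - Y t) * exp (- 2 * L * t)" for t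
    have "D t \<le> D 0"
    proof (rule DERIV_nonpos_imp_nonincreasing[OF that(1)])
      fix s
      define d where "d = X s - Y s"
      define d' where "d' = F (X s) - F (Y s)"
      have "((\<lambda>t. X t - Y t) has_vector_derivative d') (at s)"
        unfolding d'_def by (auto intro!: derivative_eq_intros X Y)
      then have "((\<lambda>t. (X t - Y t) \<bullet> (X t - Y t)) has_derivative
          (\<lambda>h. d \<bullet> (h *\<^sub>R d') + (h *\<^sub>R d') \<bullet> d)) (at s)"
        unfolding has_vector_derivative_def d_def by (intro has_derivative_inner)
      then have "((\<lambda>t. (X t - Y t) \<bullet> (X t - Y t)) has_real_derivative 2 * (d \<bullet> d')) (at s)"
        unfolding has_field_derivative_def
        by (rule has_derivative_eq_rhs) (auto simp: inner_commute algebra_simps)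
      then have "(D has_real_derivative
          2 * (d \<bullet> d') * exp (- 2 * L * s) - d \<bullet> d * (2 * L * exp (- 2 * L * s))) (at s)"
        unfolding D_def d_def by (auto intro!: derivative_eq_intros)
      moreover have "d \<bullet> d' \<le> L * (d \<bullet> d)"
      proof -
        have "d \<bullet> d' \<le> norm d * norm d'" by (rule norm_cauchy_schwarz)
        also have "\<dots> \<le> norm d * (L * norm d)"
          using lipschitz_onD[OF lip, of "X s" "Y s"]
          by (intro mult_left_mono) (auto simp: dist_norm d_def d'_def)
        also have "\<dots> = L * (d \<bullet> d)"
          by (simp add: power2_norm_eq_inner[symmetric] power2_eq_square)
        finally show ?thesis .
      qed
      then have "2 * (d \<bullet> d') * exp (- 2 * L * s) \<le> 2 * (L * (d \<bullet> d)) * exp (- 2 * L * s)"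
        by (intro mult_right_mono mult_left_mono) auto
      ultimately show "\<exists>y. (D has_real_derivative y) (at s) \<and> y \<le> 0"
        by (intro exI[of _ "2 * (d \<bullet> d') * exp (- 2 * L * s)
            - d \<bullet> d * (2 * L * exp (- 2 * L * s))"]) (simp add: algebra_simps)
    qed
    then have "D t * exp (2 * L * t) \<le> D 0 * exp (2 * L * t)"
      by (intro mult_right_mono) auto
    also have "D t * exp (2 * L * t) = (norm (X t - Y t))\<^sup>2"
      by (simp add: D_def power2_norm_eq_inner flip: exp_add)
    also have "D 0 * exp (2 * L * t) = (exp (L * t) * norm (X 0 - Y 0))\<^sup>2"
      by (simp add: D_def power2_norm_eq_inner power_mult_distrib mult.assoc flip: exp_double)
    finally show ?thesis
      by (rule power2_le_imp_le) auto
  qed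
  show ?thesis
  proof (cases "t \<ge> 0")
    case True
    then show ?thesis using pos[of t F X Y] assms by simp
  next
    case False
    have rev: "((\<lambda>t. X (- t)) has_vector_derivative - F (X (- s))) (at s)"
      if "\<And>t. (X has_vector_derivative F (X t)) (at t)" for X and s :: real
      by (rule has_vector_derivative_reflect[OF that])
    have "L-lipschitz_on UNIV (\<lambda>x. - F x)"
      using lip by (simp add: lipschitz_on_minus)
    from pos[OF _ this rev[OF X] rev[OF Y], of "- t"] False show ?thesis
      by simp
  qed
qed

section \<open>The ABC system in coordinates\<close>

lemma abs_sin_diff_le: "\<bar>sin a - sin b\<bar> \<le> \<bar>a - b\<bar>" for a b :: real
  using field_differentiable_bound[of UNIV sin cos 1 a b]
  by (auto intro!: derivative_eq_intros)

lemma abs_cos_diff_le: "\<bar>cos a - cos b\<bar> \<le> \<bar>a - b\<bar>" for a b :: real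
  using field_differentiable_bound[of UNIV cos "\<lambda>v. - sin v" 1 a b]
  by (auto intro!: derivative_eq_intros)

text \<open>Scalar form of the system, in which symmetries and energy can be treated with real
  derivatives; \<open>abc_trajectory_iff_solution\<close> connects it to the vector form.\<close>

definition abc_solution :: "real \<Rightarrow> (real \<Rightarrow> real) \<Rightarrow> (real \<Rightarrow> real) \<Rightarrow> (real \<Rightarrow> real) \<Rightarrow> bool" where
  "abc_solution e x y z \<longleftrightarrow> (\<forall>t.
     (x has_real_derivative cos (y t) + e * sin (z t)) (at t) \<and>
     (y has_real_derivative sin (x t) + e * cos (z t)) (at t) \<and>
     (z has_real_derivative cos (x t) + sin (y t)) (at t))"

lemma abc_solutionD:
  assumes "abc_solution e x y z"
  shows "(x has_real_derivative cos (y t) + e * sin (z t)) (at t)"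
    and "(y has_real_derivative sin (x t) + e * cos (z t)) (at t)"
    and "(z has_real_derivative cos (x t) + sin (y t)) (at t)"
  using assms by (auto simp: abc_solution_def)

lemma abc_solution_continuous:
  assumes "abc_solution e x y z"
  shows "continuous_on S x" "continuous_on S y" "continuous_on S z"
  by (rule continuous_at_imp_continuous_on, rule ballI, rule DERIV_isCont,
      rule abc_solutionD[OF assms])+

lemma has_vector_derivative_cart3:
  fixes X :: "real \<Rightarrow> real^3"
  shows "(X has_vector_derivative D) (at t) \<longleftrightarrow>
    (\<forall>i. ((\<lambda>t. X t $ i) has_real_derivative D $ i) (at t))"
  unfolding has_vector_derivative_def has_field_derivative_def
  by (subst has_derivative_componentwise_within)
    (auto simp: Basis_vec_def inner_axis mult_commute_abs)

lemma abc_trajectory_iff_solution: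
  "abc_trajectory e 1 1 X \<longleftrightarrow> abc_solution e (\<lambda>t. X t $ 1) (\<lambda>t. X t $ 2) (\<lambda>t. X t $ 3)"
  by (auto simp: abc_trajectory_def abc_solution_def has_vector_derivative_cart3 forall_3
      abc_field_def add.commute)

lemma abc_trajectory_vector:
  "abc_solution e x y z \<Longrightarrow> abc_trajectory e 1 1 (\<lambda>t. vector [x t, y t, z t])"
  by (simp add: abc_trajectory_iff_solution)

lemma translating_trajectory:
  fixes v :: "real^3"
  assumes "abc_solution e x y z"
    and "\<And>t. x (t + T) = x t + v $ 1" "\<And>t. y (t + T) = y t + v $ 2" "\<And>t. z (t + T) = z t + v $ 3"
  shows "\<exists>X. abc_trajectory e 1 1 X \<and> (\<forall>t. X (t + T) = X t + v)"
  using assms by (intro exI[of _ "\<lambda>t. vector [x t, y t, z t]"])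
    (auto simp: abc_trajectory_vector vec_eq_iff forall_3)

section \<open>Existence, uniqueness and continuous dependence for the ABC system\<close>

lemma abc_field_lipschitz:
  assumes e: "\<bar>e\<bar> \<le> 1"
  shows "6-lipschitz_on UNIV (abc_field e 1 1)"
proof (rule lipschitz_onI)
  fix p q :: "real^3"
  have c: "\<bar>p $ i - q $ i\<bar> \<le> norm (p - q)" for i
    using component_le_norm_cart[of "p - q" i] by simp
  have s: "\<bar>sin (p $ i) - sin (q $ i)\<bar> \<le> norm (p - q)" for i
    using abs_sin_diff_le c order_trans by blast
  have k: "\<bar>cos (p $ i) - cos (q $ i)\<bar> \<le> norm (p - q)" for i
    using abs_cos_diff_le c order_trans by blast
  have es: "\<bar>e * (sin (p $ i) - sin (q $ i))\<bar> \<le> norm (p - q)" for i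
    using mult_mono[OF e s[of i]] by (simp add: abs_mult)
  have ek: "\<bar>e * (cos (p $ i) - cos (q $ i))\<bar> \<le> norm (p - q)" for i
    using mult_mono[OF e k[of i]] by (simp add: abs_mult)
  \<comment> \<open>The constant 6 counts the trigonometric terms of the field: each changes by at
    most \<open>norm (p - q)\<close>, and the sum of absolute components dominates the norm.\<close>
  have "norm (abc_field e 1 1 p - abc_field e 1 1 q)
      \<le> (\<Sum>i\<in>UNIV. \<bar>(abc_field e 1 1 p - abc_field e 1 1 q) $ i\<bar>)"
    by (rule norm_le_l1_cart)
  also have "\<dots> = \<bar>e * (sin (p $ 3) - sin (q $ 3)) + (cos (p $ 2) - cos (q $ 2))\<bar>
      + \<bar>(sin (p $ 1) - sin (q $ 1)) + e * (cos (p $ 3) - cos (q $ 3))\<bar>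
      + \<bar>(sin (p $ 2) - sin (q $ 2)) + (cos (p $ 1) - cos (q $ 1))\<bar>"
    by (simp add: sum_3 abc_field_def algebra_simps)
  also have "\<dots> \<le> 6 * norm (p - q)"
    using s[of 1] s[of 2] k[of 1] k[of 2] es[of 3] ek[of 3] by linarith
  finally show "dist (abc_field e 1 1 p) (abc_field e 1 1 q) \<le> 6 * dist p q"
    by (simp add: dist_norm)
qed simp

lemma abc_field_bounded:
  assumes e: "\<bar>e\<bar> \<le> 1"
  shows "bounded (range (abc_field e 1 1))"
proof -
  have "norm (abc_field e 1 1 p) \<le> 6" for p
  proof -
    have es: "\<bar>e * sin a\<bar> \<le> 1" and ek: "\<bar>e * cos a\<bar> \<le> 1" for a
      using mult_mono[OF e abs_sin_le_one[of a]] mult_mono[OF e abs_cos_le_one[of a]]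
      by (simp_all add: abs_mult)
    have "norm (abc_field e 1 1 p) \<le> (\<Sum>i\<in>UNIV. \<bar>abc_field e 1 1 p $ i\<bar>)"
      by (rule norm_le_l1_cart)
    also have "\<dots> = \<bar>e * sin (p $ 3) + cos (p $ 2)\<bar> + \<bar>sin (p $ 1) + e * cos (p $ 3)\<bar>
        + \<bar>sin (p $ 2) + cos (p $ 1)\<bar>"
      by (simp add: sum_3 abc_field_def)
    also have "\<dots> \<le> 6"
      using es[of "p $ 3"] ek[of "p $ 3"] abs_sin_le_one[of "p $ 1"] abs_sin_le_one[of "p $ 2"]
        abs_cos_le_one[of "p $ 1"] abs_cos_le_one[of "p $ 2"] by linarith
    finally show ?thesis .
  qed
  then show ?thesis by (auto simp: bounded_iff)
qed

lemma abc_solution_exists: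
  assumes "\<bar>e\<bar> \<le> 1"
  obtains x y z where "abc_solution e x y z" "x 0 = a" "y 0 = b" "z 0 = c"
proof -
  obtain X where X0: "X 0 = (vector [a, b, c] :: real^3)"
    and X: "\<And>t. (X has_vector_derivative abc_field e 1 1 (X t)) (at t)"
    using lipschitz_ode_solution_exists[OF abc_field_lipschitz[OF assms] abc_field_bounded[OF assms]]
    by blast
  have "abc_solution e (\<lambda>t. X t $ 1) (\<lambda>t. X t $ 2) (\<lambda>t. X t $ 3)"
    using X by (simp add: abc_trajectory_def flip: abc_trajectory_iff_solution)
  then show thesis by (rule that) (simp_all add: X0)
qed

lemma abc_solution_dependence:
  fixes t :: real
  assumes "\<bar>e\<bar> \<le> 1" "abc_solution e x y z" "abc_solution e x' y' z'"
  defines "d \<equiv> exp (6 * \<bar>t\<bar>) * (\<bar>x 0 - x' 0\<bar> + \<bar>y 0 - y' 0\<bar> + \<bar>z 0 - z' 0\<bar>)"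
  shows "\<bar>x t - x' t\<bar> \<le> d" "\<bar>y t - y' t\<bar> \<le> d" "\<bar>z t - z' t\<bar> \<le> d"
proof -
  define X X' :: "real \<Rightarrow> real^3"
    where "X t = vector [x t, y t, z t]" and "X' t = vector [x' t, y' t, z' t]" for t
  have "(X has_vector_derivative abc_field e 1 1 (X t)) (at t)"
    "(X' has_vector_derivative abc_field e 1 1 (X' t)) (at t)" for t
    using abc_trajectory_vector[OF assms(2)] abc_trajectory_vector[OF assms(3)]
    by (simp_all add: abc_trajectory_def X_def[abs_def] X'_def[abs_def])
  note lipschitz_ode_dependence[OF abc_field_lipschitz[OF assms(1)] this, of t]
  also have "exp (6 * \<bar>t\<bar>) * norm (X 0 - X' 0) \<le> d"
    using norm_le_l1_cart[of "X 0 - X' 0"]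
    by (simp add: d_def sum_3 X_def X'_def)
  finally have *: "norm (X t - X' t) \<le> d" .
  have "\<bar>(X t - X' t) $ i\<bar> \<le> d" for i
    using component_le_norm_cart[of "X t - X' t" i] * by linarith
  from this[of 1] this[of 2] this[of 3]
  show "\<bar>x t - x' t\<bar> \<le> d" "\<bar>y t - y' t\<bar> \<le> d" "\<bar>z t - z' t\<bar> \<le> d"
    by (simp_all add: X_def X'_def)
qed

lemma abc_solution_unique:
  assumes "\<bar>e\<bar> \<le> 1" "abc_solution e x y z" "abc_solution e x' y' z'"
    and "x 0 = x' 0" "y 0 = y' 0" "z 0 = z' 0"
  shows "x t = x' t" "y t = y' t" "z t = z' t"
  using abc_solution_dependence[OF assms(1-3), of t] assms(4-6) by auto

section \<open>Symmetries\<close>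

lemma abc_solution_shift:
  assumes "abc_solution e x y z"
  shows "abc_solution e (\<lambda>t. x (c + t)) (\<lambda>t. y (c + t)) (\<lambda>t. z (c + t))"
  unfolding abc_solution_def
proof
  fix t
  show "((\<lambda>t. x (c + t)) has_real_derivative cos (y (c + t)) + e * sin (z (c + t))) (at t) \<and>
    ((\<lambda>t. y (c + t)) has_real_derivative sin (x (c + t)) + e * cos (z (c + t))) (at t) \<and>
    ((\<lambda>t. z (c + t)) has_real_derivative cos (x (c + t)) + sin (y (c + t))) (at t)"
    using abc_solutionD[OF assms, of "c + t"] by (simp add: DERIV_shift add.commute[of c])
qed

text \<open>The derivative is a variable \<open>D\<close> with an equation as premise, so that these
  rules combine with \<open>derivative_eq_intros\<close>.\<close>

lemma abc_solution_reflectD: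
  assumes "abc_solution e x y z"
  shows "D = - (cos (y (- t)) + e * sin (z (- t))) \<Longrightarrow> ((\<lambda>t. x (- t)) has_real_derivative D) (at t)"
    and "D = - (sin (x (- t)) + e * cos (z (- t))) \<Longrightarrow> ((\<lambda>t. y (- t)) has_real_derivative D) (at t)"
    and "D = - (cos (x (- t)) + sin (y (- t))) \<Longrightarrow> ((\<lambda>t. z (- t)) has_real_derivative D) (at t)"
  using abc_solutionD[OF assms, of "- t"] by (simp_all add: DERIV_mirror)

context
  fixes e x y z
  assumes sol: "abc_solution e x y z"
begin

text \<open>In the numbered reversals the digits stand for x, y, z: 1 means that the coordinate
  keeps its sign, 0 that it is negated, in both cases up to a constant.\<close>

lemma reversal_111: "abc_solution e (\<lambda>t. pi + x (- t)) (\<lambda>t. pi + y (- t)) (\<lambda>t. pi + z (- t))"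
  unfolding abc_solution_def
  by (auto intro!: derivative_eq_intros abc_solution_reflectD[OF sol] simp: sin_add cos_add)

lemma reversal_100: "abc_solution e (\<lambda>t. x (- t)) (\<lambda>t. pi - y (- t)) (\<lambda>t. - z (- t))"
  unfolding abc_solution_def
  by (auto intro!: derivative_eq_intros abc_solution_reflectD[OF sol] simp: sin_diff cos_diff)

lemma reversal_001: "abc_solution e (\<lambda>t. pi - x (- t)) (\<lambda>t. 2 * pi - y (- t)) (\<lambda>t. z (- t))"
  unfolding abc_solution_def
  by (auto intro!: derivative_eq_intros abc_solution_reflectD[OF sol] simp: sin_diff cos_diff)

lemma reversal_swap:
  "abc_solution e (\<lambda>t. pi / 2 - y (- t)) (\<lambda>t. pi / 2 - x (- t)) (\<lambda>t. pi / 2 - z (- t))"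
  unfolding abc_solution_def
  by (auto intro!: derivative_eq_intros abc_solution_reflectD[OF sol] simp: sin_diff cos_diff)

lemma symmetry_swap: "abc_solution e (\<lambda>t. y t + pi / 2) (\<lambda>t. x t - pi / 2) (\<lambda>t. pi / 2 - z t)"
  unfolding abc_solution_def
  by (auto intro!: derivative_eq_intros abc_solutionD[OF sol] simp: sin_diff cos_diff sin_add cos_add)

end

context
  fixes e x y z
  assumes sol: "abc_solution e x y z"
begin

text \<open>The point with x = pi/2, y = pi and any z is fixed by \<open>reversal_001\<close>. With
  time \<tau> as origin, the trajectory and its reversal have the same initial value, so they
  coincide by uniqueness.\<close>

lemma reflection_at_crossing:
  assumes e: "\<bar>e\<bar> \<le> 1" and "x \<tau> = pi / 2" "y \<tau> = pi"
  shows "x (2 * \<tau> + t) = pi - x (- t)" "y (2 * \<tau> + t) = 2 * pi - y (- t)" "z (2 * \<tau> + t) = z (- t)"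
proof -
  have s: "abc_solution e (\<lambda>t. x (\<tau> + t)) (\<lambda>t. y (\<tau> + t)) (\<lambda>t. z (\<tau> + t))"
    by (rule abc_solution_shift[OF sol])
  have "abc_solution e (\<lambda>t. pi - x (\<tau> + - t)) (\<lambda>t. 2 * pi - y (\<tau> + - t)) (\<lambda>t. z (\<tau> + - t))"
    by (rule reversal_001[OF s])
  note * = abc_solution_unique[OF e s this, of "\<tau> + t"]
  show "x (2 * \<tau> + t) = pi - x (- t)" "y (2 * \<tau> + t) = 2 * pi - y (- t)" "z (2 * \<tau> + t) = z (- t)"
    using * assms by simp_all
qed

text \<open>\<open>reversal_swap\<close> fixes the initial point. Composed with the reflection at
  \<tau> it shows that advancing time by 2\<tau> acts as (y + pi/2, x + 3pi/2, pi/2 - z); the square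
  of this map is the translation by (2pi, 2pi, 0).\<close>

lemma diagonal_orbit_translation:
  assumes e: "\<bar>e\<bar> \<le> 1" and "x \<tau> = pi / 2" "y \<tau> = pi" and "x 0 + y 0 = pi / 2" "z 0 = pi / 4"
  shows "x (t + 4 * \<tau>) = x t + 2 * pi" "y (t + 4 * \<tau>) = y t + 2 * pi" "z (t + 4 * \<tau>) = z t"
proof -
  note R = reflection_at_crossing[OF assms(1-3)]
  have "x (- t) = pi / 2 - y t" "y (- t) = pi / 2 - x t" "z (- t) = pi / 2 - z t" for t
    using abc_solution_unique[OF e sol reversal_swap[OF sol], of "- t"] assms
    by (simp_all add: algebra_simps)
  with R have *: "x (2 * \<tau> + t) = y t + pi / 2" "y (2 * \<tau> + t) = x t + 3 * pi / 2"
    "z (2 * \<tau> + t) = pi / 2 - z t" for t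
    by simp_all
  have "t + 4 * \<tau> = 2 * \<tau> + (2 * \<tau> + t)" by simp
  then show "x (t + 4 * \<tau>) = x t + 2 * pi" "y (t + 4 * \<tau>) = y t + 2 * pi" "z (t + 4 * \<tau>) = z t"
    by (simp_all only: *)
qed

text \<open>Here \<open>reversal_100\<close> fixes the initial point, and advancing time by 2\<tau>
  acts as (pi - x, y + pi, -z), whose square is the translation by (0, 2pi, 0).\<close>

lemma axis_orbit_translation:
  assumes e: "\<bar>e\<bar> \<le> 1" and "x \<tau> = pi / 2" "y \<tau> = pi" and "y 0 = pi / 2" "z 0 = 0"
  shows "x (t + 4 * \<tau>) = x t" "y (t + 4 * \<tau>) = y t + 2 * pi" "z (t + 4 * \<tau>) = z t"
proof -
  note R = reflection_at_crossing[OF assms(1-3)]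
  have init: "x 0 = x (- 0)" "y 0 = pi - y (- 0)" "z 0 = - z (- 0)"
    using assms by simp_all
  have "x (- t) = x t" "y (- t) = pi - y t" "z (- t) = - z t" for t
    using abc_solution_unique[OF e sol reversal_100[OF sol] init, of "- t"] by simp_all
  with R have *: "x (2 * \<tau> + t) = pi - x t" "y (2 * \<tau> + t) = y t + pi" "z (2 * \<tau> + t) = - z t" for t
    by simp_all
  have "t + 4 * \<tau> = 2 * \<tau> + (2 * \<tau> + t)" by simp
  then show "x (t + 4 * \<tau>) = x t" "y (t + 4 * \<tau>) = y t + 2 * pi" "z (t + 4 * \<tau>) = z t"
    by (simp_all only: *)
qed

end

section \<open>Passage along the heteroclinic net\<close>

lemma first_zero:
  fixes m :: "real \<Rightarrow> real"
  assumes cont: "continuous_on {0..t} m" and start: "m 0 > 0" and t: "0 \<le> t" "m t \<le> 0"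
  obtains u where "0 < u" "u \<le> t" "m u = 0" "\<And>s. \<lbrakk>0 \<le> s; s < u\<rbrakk> \<Longrightarrow> m s > 0"
proof -
  define Z where "Z = {s \<in> {0..t}. m s = 0}"
  have zero_before: "\<exists>u\<in>Z. u \<le> s" if "0 \<le> s" "s \<le> t" "m s \<le> 0" for s
  proof -
    have "continuous_on {0..s} m"
      using cont that by (auto intro: continuous_on_subset)
    then have "\<exists>u\<ge>0. u \<le> s \<and> m u = 0"
      using that start by (intro IVT2') auto
    then show ?thesis using that by (auto simp: Z_def)
  qed
  have "closed Z"
    unfolding Z_def by (rule continuous_closed_preimage_constant[OF cont]) simp
  moreover have "bounded Z"
    by (rule bounded_subset[of "{0..t}"]) (auto simp: Z_def)
  ultimately have "compact Z" by (simp add: compact_eq_bounded_closed)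
  moreover have "Z \<noteq> {}" using zero_before[of t] t by auto
  ultimately obtain u where u: "u \<in> Z" "\<And>v. v \<in> Z \<Longrightarrow> u \<le> v"
    using compact_attains_inf by metis
  then have u': "0 \<le> u" "u \<le> t" "m u = 0" by (auto simp: Z_def)
  have "m s > 0" if "0 \<le> s" "s < u" for s
    using zero_before[of s] u(2) u' that by force
  moreover have "u \<noteq> 0" using u' start by auto
  ultimately show thesis using that[of u] u' by simp
qed

text \<open>At a first zero of \<open>m\<close> the weak inequality holds on the whole past, so
  \<open>step\<close> gives strict positivity there, a contradiction. It turns estimates valid in a
  closed region into a proof that the region is never left.\<close>

lemma nonneg_imp_pos_bootstrap:
  fixes m :: "real \<Rightarrow> real"
  assumes cont: "continuous_on {0..T} m" and start: "m 0 > 0"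
    and step: "\<And>t. \<lbrakk>0 \<le> t; t \<le> T; \<And>s. \<lbrakk>0 \<le> s; s \<le> t\<rbrakk> \<Longrightarrow> m s \<ge> 0\<rbrakk> \<Longrightarrow> m t > 0"
    and t: "0 \<le> t" "t \<le> T"
  shows "m t > 0"
proof (rule ccontr)
  assume "\<not> m t > 0"
  moreover have "continuous_on {0..t} m"
    using cont t by (auto intro: continuous_on_subset)
  ultimately obtain u where u: "0 < u" "u \<le> t" "m u = 0"
    and pos: "\<And>s. \<lbrakk>0 \<le> s; s < u\<rbrakk> \<Longrightarrow> m s > 0"
    using first_zero[of t m] start t by (auto simp: not_less)
  have "m s \<ge> 0" if "0 \<le> s" "s \<le> u" for s
    using pos[of s] u that by (cases "s = u") auto
  then have "m u > 0" using step[of u] u t by auto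
  then show False using u by simp
qed

section \<open>Approximate conservation of the energy\<close>

definition energy :: "(real \<Rightarrow> real) \<Rightarrow> (real \<Rightarrow> real) \<Rightarrow> real \<Rightarrow> real" where
  "energy x y t = sin (y t) + cos (x t)"

text \<open>Along solutions the energy \<open>H\<close> satisfies \<open>H' = e * (x' * cos z - y' * sin z)\<close>, so that
  \<open>H - e * (x * cos z - y * sin z)\<close> has the small derivative \<open>e * (x * sin z + y * cos z) * H\<close>.\<close>

lemma energy_estimates:
  assumes sol: "abc_solution e x y z" and e: "0 < e" and T: "0 \<le> T" "14 * e * T \<le> 1"
    and region: "\<And>t. \<lbrakk>0 \<le> t; t \<le> T\<rbrakk> \<Longrightarrow> 0 \<le> x t \<and> x t \<le> pi \<and> 0 \<le> y t \<and> y t \<le> pi"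
    and start: "\<bar>energy x y 0\<bar> \<le> 3 * e"
    and t: "0 \<le> t" "t \<le> T"
  shows "\<bar>energy x y t\<bar> \<le> 34 * e"
    and "\<bar>z t - z 0\<bar> \<le> 34 * e * T"
    and "\<bar>energy x y t - energy x y 0 - e * ((x t - x 0) * cos (z 0) - (y t - y 0) * sin (z 0))\<bar>
      \<le> 476 * e * e * T"
proof -
  note D = abc_solutionD[OF sol]
  define H where "H = energy x y"
  define G where "G t = H t - e * (x t * cos (z t) - y t * sin (z t))" for t
  \<comment> \<open>The region bounds the sum by 2pi, which is less than 7.\<close>
  have xy: "\<bar>x s\<bar> + \<bar>y s\<bar> \<le> 7" if "0 \<le> s" "s \<le> T" for s
    using region[OF that] pi_less_4 pi_approx by auto
  have xyc: "\<bar>x s * a + y s * b\<bar> \<le> 7 * c" if "0 \<le> s" "s \<le> T" "\<bar>a\<bar> \<le> c" "\<bar>b\<bar> \<le> c" for s a b c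
  proof -
    have "\<bar>x s * a + y s * b\<bar> \<le> \<bar>x s\<bar> * \<bar>a\<bar> + \<bar>y s\<bar> * \<bar>b\<bar>"
      by (metis abs_mult abs_triangle_ineq)
    also have "\<dots> \<le> \<bar>x s\<bar> * c + \<bar>y s\<bar> * c"
      using that by (intro add_mono mult_left_mono) auto
    also have "\<dots> = (\<bar>x s\<bar> + \<bar>y s\<bar>) * c" by (simp add: algebra_simps)
    also have "\<dots> \<le> 7 * c"
      using xy[of s] that by (intro mult_right_mono) auto
    finally show ?thesis .
  qed
  have contH: "continuous_on {0..T} H"
    unfolding H_def energy_def by (intro continuous_intros abc_solution_continuous[OF sol])
  have DG: "(G has_real_derivative e * (x s * sin (z s) + y s * cos (z s)) * H s) (at s)" for s
    unfolding G_def H_def energy_def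
    by (auto intro!: derivative_eq_intros D simp: algebra_simps)
  \<comment> \<open>The drift of \<open>G\<close> is bounded by the maximum \<open>M\<close> of the
    absolute energy itself, so the estimate is closed by absorption at a maximum point
    \<open>u\<close>.\<close>
  have "\<exists>u\<in>{0..T}. \<forall>s\<in>{0..T}. \<bar>H s\<bar> \<le> \<bar>H u\<bar>"
    using contH T by (intro continuous_attains_sup continuous_intros) auto
  then obtain u where u: "0 \<le> u" "u \<le> T" and "\<And>s. \<lbrakk>0 \<le> s; s \<le> T\<rbrakk> \<Longrightarrow> \<bar>H s\<bar> \<le> \<bar>H u\<bar>"
    by auto
  then obtain M where M: "M = \<bar>H u\<bar>" and HM: "\<And>s. \<lbrakk>0 \<le> s; s \<le> T\<rbrakk> \<Longrightarrow> \<bar>H s\<bar> \<le> M"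
    by blast
  have M0: "M \<ge> 0" using M by simp
  have G_diff: "\<bar>G s - G 0\<bar> \<le> 7 * e * M * T" if "0 \<le> s" "s \<le> T" for s
  proof -
    have "norm (G s - G 0) \<le> 7 * e * M * norm (s - 0)"
    proof (rule field_differentiable_bound)
      show "(G has_real_derivative e * (x v * sin (z v) + y v * cos (z v)) * H v)
          (at v within {0..T})" for v
        using DG has_field_derivative_at_within by blast
      fix v assume v: "v \<in> {0..T}"
      have "\<bar>e * (x v * sin (z v) + y v * cos (z v)) * H v\<bar> \<le> e * (7 * 1) * M"
        unfolding abs_mult
        using v e HM[of v] by (intro mult_mono xyc) auto
      then show "norm (e * (x v * sin (z v) + y v * cos (z v)) * H v) \<le> 7 * e * M"
        by simp
    qed (use that in auto)
    also have "\<dots> \<le> 7 * e * M * T"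
      using that e M0 by (intro mult_left_mono) auto
    finally show ?thesis by simp
  qed
  have HG: "\<bar>H s - G s\<bar> \<le> 7 * e" if "0 \<le> s" "s \<le> T" for s
  proof -
    have "\<bar>H s - G s\<bar> = e * \<bar>x s * cos (z s) + y s * (- sin (z s))\<bar>"
      using e by (simp add: G_def abs_mult)
    also have "\<dots> \<le> e * (7 * 1)"
      using e that by (intro mult_left_mono xyc) auto
    finally show ?thesis by simp
  qed
  \<comment> \<open>Then \<open>M\<close> is at most M/2 + 3e + 7e + 7e: the drift of
    \<open>G\<close>, the initial energy, and the gap between \<open>H\<close> and \<open>G\<close>
    at times 0 and \<open>u\<close>. This gives 34e.\<close>
  have "7 * e * M * T \<le> M / 2"
    using mult_right_mono[OF T(2) M0] by (simp add: mult_ac)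
  then have M_le: "M \<le> 34 * e"
    using HG[OF u] G_diff[OF u] HG[of 0] start T unfolding M H_def[symmetric] by simp
  show "\<bar>energy x y t\<bar> \<le> 34 * e"
    using HM[OF t] M_le by (simp add: H_def)
  have "norm (z t - z 0) \<le> 34 * e * norm (t - 0)"
  proof (rule field_differentiable_bound)
    show "(z has_real_derivative H v) (at v within {0..T})" for v
      using D(3)[of v] has_field_derivative_at_within
      by (fastforce simp: H_def energy_def add.commute)
    show "norm (H v) \<le> 34 * e" if "v \<in> {0..T}" for v
      using HM[of v] M_le that by simp
  qed (use t in auto)
  also have "\<dots> \<le> 34 * e * T"
    using t e by (intro mult_left_mono) auto
  finally show z: "\<bar>z t - z 0\<bar> \<le> 34 * e * T" by simp
  have "\<bar>cos (z t) - cos (z 0)\<bar> \<le> \<bar>z t - z 0\<bar>"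
    by (rule abs_cos_diff_le)
  moreover have "\<bar>sin (z 0) - sin (z t)\<bar> \<le> \<bar>z t - z 0\<bar>"
    using abs_sin_diff_le[of "z 0" "z t"] by simp
  ultimately have "\<bar>x t * (cos (z t) - cos (z 0)) + y t * (sin (z 0) - sin (z t))\<bar>
      \<le> 7 * (34 * e * T)"
    using z t by (intro xyc) auto
  then have "e * \<bar>x t * (cos (z t) - cos (z 0)) + y t * (sin (z 0) - sin (z t))\<bar>
      \<le> e * (7 * (34 * e * T))"
    using e by (intro mult_left_mono) auto
  then have "\<bar>e * (x t * (cos (z t) - cos (z 0)) + y t * (sin (z 0) - sin (z t)))\<bar>
      \<le> 238 * e * e * T"
    using e by (simp add: abs_mult)
  moreover have "\<bar>G t - G 0\<bar> \<le> 238 * e * e * T"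
  proof -
    have "7 * e * M * T \<le> 7 * e * (34 * e) * T"
      using M_le e T by (intro mult_right_mono mult_left_mono) auto
    also have "\<dots> = 238 * e * e * T" by simp
    finally show ?thesis using G_diff[OF t] by linarith
  qed
  \<comment> \<open>The error has two sources, the replacement of z(t) by z(0) and the drift of
    \<open>G\<close>. Each contributes 7 * 34 = 238, hence 476.\<close>
  moreover have "energy x y t - energy x y 0 - e * ((x t - x 0) * cos (z 0) - (y t - y 0) * sin (z 0))
     = e * (x t * (cos (z t) - cos (z 0)) + y t * (sin (z 0) - sin (z t))) + (G t - G 0)"
    by (simp add: G_def H_def algebra_simps)
  ultimately show "\<bar>energy x y t - energy x y 0
      - e * ((x t - x 0) * cos (z 0) - (y t - y 0) * sin (z 0))\<bar> \<le> 476 * e * e * T"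
    by linarith
qed

text \<open>By the last estimate, the assumption \<open>far\<close> keeps the energy above \<open>r\<^sup>2 / 20\<close> while \<open>x \<ge> 2 * pi / 3\<close> and
  \<open>y \<le> pi\<close>, which prevents the solution from being caught at the saddle \<open>(pi, pi / 2)\<close>.\<close>

locale passage =
  fixes r h :: real and x y z :: "real \<Rightarrow> real"
  assumes sol: "abc_solution (r\<^sup>2) x y z"
    and r: "0 < r" "r \<le> 1 / 10 ^ 6"
    and x0: "0 < x 0" "x 0 < pi" and y0: "0 < y 0" "y 0 < pi" and z0: "0 \<le> z 0" "z 0 \<le> pi / 4"
    and energy0: "energy x y 0 = r\<^sup>2 * h" and h: "\<bar>h\<bar> \<le> 3"
    and far: "h + (2 * pi / 3 - x 0) * cos (z 0) - (pi - y 0) * sin (z 0) \<ge> 1 / 10"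
begin

lemma trig_z0: "0 < cos (z 0)" "0 \<le> sin (z 0)"
  using z0 pi_gt3 by (intro cos_gt_zero_pi sin_ge_zero; linarith)+

lemma estimates:
  assumes T: "0 \<le> T" "T \<le> 16 / r"
    and region: "\<And>t. \<lbrakk>0 \<le> t; t \<le> T\<rbrakk> \<Longrightarrow> 0 \<le> x t \<and> x t \<le> pi \<and> 0 \<le> y t \<and> y t \<le> pi"
    and t: "0 \<le> t" "t \<le> T"
  shows "\<bar>energy x y t\<bar> \<le> 34 * r\<^sup>2"
    and "\<bar>z t - z 0\<bar> \<le> 1 / 100"
    and "\<bar>energy x y t - r\<^sup>2 * (h + (x t - x 0) * cos (z 0) - (y t - y 0) * sin (z 0))\<bar>
      \<le> r\<^sup>2 / 20"
proof -
  have r0: "r\<^sup>2 > 0" using r by simp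
  have "r\<^sup>2 * T \<le> r\<^sup>2 * (16 / r)"
    using T by (intro mult_left_mono) auto
  also have "\<dots> = 16 * r" using r by (simp add: power2_eq_square)
  finally have rT: "r\<^sup>2 * T \<le> 16 / 10 ^ 6" using r by simp
  have *: "\<bar>energy x y 0\<bar> \<le> 3 * r\<^sup>2"
    using mult_right_mono[OF h, of "r\<^sup>2"] energy0 by (simp add: abs_mult mult.commute)
  have **: "14 * r\<^sup>2 * T \<le> 1" using rT by simp
  note est = energy_estimates[OF sol r0 T(1) ** region * t]
  show "\<bar>energy x y t\<bar> \<le> 34 * r\<^sup>2" using est(1) by simp
  show "\<bar>z t - z 0\<bar> \<le> 1 / 100" using est(2) rT by simp
  have "r\<^sup>2 * (476 * (r\<^sup>2 * T)) \<le> r\<^sup>2 * (1 / 20)"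
    using rT by (intro mult_left_mono) auto
  then show "\<bar>energy x y t - r\<^sup>2 * (h + (x t - x 0) * cos (z 0) - (y t - y 0) * sin (z 0))\<bar>
      \<le> r\<^sup>2 / 20"
    using est(3) energy0 by (simp add: algebra_simps)
qed

text \<open>This bounds y' from below. Since sin y is nonnegative, small energy makes cos x at most
  1/2. If x is at most 2pi/3, then sin x is bounded away from 0; beyond that, \<open>far\<close>
  keeps the energy positive of order r^2, so x keeps a distance of order r from pi.\<close>

lemma speed:
  assumes T: "0 \<le> T" "T \<le> 16 / r"
    and region: "\<And>t. \<lbrakk>0 \<le> t; t \<le> T\<rbrakk> \<Longrightarrow> 0 \<le> x t \<and> x t \<le> pi \<and> 0 \<le> y t \<and> y t \<le> pi"
    and t: "0 \<le> t" "t \<le> T"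
  shows "0 < x t" "x t < pi" "r / 5 \<le> sin (x t) + r\<^sup>2 * cos (z t)"
proof -
  note est = estimates[OF T region t]
  note reg = region[OF t]
  have r2: "0 < r\<^sup>2" "r\<^sup>2 \<le> 1 / 10 ^ 12"
    using r power_mono[of r "1 / 10 ^ 6" 2] by (auto simp: power_divide)
  have "sin (y t) \<ge> 0" using reg by (intro sin_ge_zero) auto
  then have cos_le: "cos (x t) \<le> 34 * r\<^sup>2"
    using est(1) by (simp add: energy_def)
  then have cos_le': "cos (x t) \<le> 1 / 2" using r2 by simp
  have sin_sq: "(sin (x t))\<^sup>2 \<ge> (r / 5)\<^sup>2"
  proof (cases "x t \<le> 2 * pi / 3")
    case True
    then have "cos (2 * pi / 3) \<le> cos (x t)"
      using reg by (intro cos_monotone_0_pi_le) auto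
    then have "\<bar>cos (x t)\<bar> \<le> 1 / 2"
      using cos_le' by (simp add: cos_120)
    then have "(cos (x t))\<^sup>2 \<le> (1 / 2)\<^sup>2"
      by (metis abs_ge_zero power2_abs power_mono)
    then have "(sin (x t))\<^sup>2 \<ge> 3 / 4"
      by (simp add: sin_squared_eq power_divide)
    then show ?thesis using r2 by (simp add: power_divide)
  next
    case False
    \<comment> \<open>The predicted energy increases with x and does not increase with y, so its
      value at (2pi/3, pi), which \<open>far\<close> bounds, is a lower bound here. The estimation
      error takes away at most half of 1/10.\<close>
    have "1 / 10 \<le> h + (2 * pi / 3 - x 0) * cos (z 0) - (pi - y 0) * sin (z 0)"
      by (rule far)
    also have "\<dots> \<le> h + (x t - x 0) * cos (z 0) - (y t - y 0) * sin (z 0)"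
      using False reg trig_z0 by (intro diff_mono add_mono mult_right_mono) auto
    finally have "r\<^sup>2 * (1 / 10) \<le> r\<^sup>2 * (h + (x t - x 0) * cos (z 0) - (y t - y 0) * sin (z 0))"
      by (intro mult_left_mono) auto
    then have "energy x y t \<ge> r\<^sup>2 / 20" using est(3) by linarith
    then have c: "1 + cos (x t) \<ge> r\<^sup>2 / 20"
      using sin_le_one[of "y t"] unfolding energy_def by linarith
    have "cos (x t) \<le> cos (2 * pi / 3)"
      using False reg by (intro cos_monotone_0_pi_le) auto
    then have c': "1 \<le> 1 - cos (x t)" by (simp add: cos_120)
    \<comment> \<open>As sin^2 x = (1 - cos x)(1 + cos x) is at least r^2/20, the slightly smaller
      r^2/25 gives a rational root.\<close>
    have "(r / 5)\<^sup>2 \<le> 1 * (r\<^sup>2 / 20)" by (simp add: power_divide)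
    also have "\<dots> \<le> (1 - cos (x t)) * (1 + cos (x t))"
      using c c' r2 by (intro mult_mono) auto
    also have "\<dots> = (sin (x t))\<^sup>2"
      by (simp add: sin_squared_eq power2_eq_square algebra_simps)
    finally show ?thesis .
  qed
  moreover have "sin (x t) \<ge> 0" using reg by (intro sin_ge_zero) auto
  ultimately have sin_ge: "sin (x t) \<ge> r / 5"
    by (rule power2_le_imp_le)
  have "x t \<noteq> 0" "x t \<noteq> pi" using sin_ge r by auto
  then show "0 < x t" "x t < pi" using reg by auto
  have "cos (z t) \<ge> 0"
    using est(2) z0 pi_gt3 by (intro cos_ge_zero; linarith)
  then show "r / 5 \<le> sin (x t) + r\<^sup>2 * cos (z t)"
    using sin_ge r2 by (simp add: add_increasing2)
qed

lemma region:
  assumes T: "0 \<le> T" "T \<le> 16 / r" and y: "\<And>t. \<lbrakk>0 \<le> t; t \<le> T\<rbrakk> \<Longrightarrow> y t \<le> pi"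
    and t: "0 \<le> t" "t \<le> T"
  shows "0 < x t" "x t < pi" "y 0 + r / 5 * t \<le> y t" "r / 5 \<le> sin (x t) + r\<^sup>2 * cos (z t)"
proof -
  have growth: "y 0 + r / 5 * s \<le> y s"
    if s: "0 \<le> s" "s \<le> T"
      and reg: "\<And>v. \<lbrakk>0 \<le> v; v \<le> s\<rbrakk> \<Longrightarrow> 0 \<le> x v \<and> x v \<le> pi \<and> 0 \<le> y v \<and> y v \<le> pi" for s
  proof -
    have "y 0 - r / 5 * 0 \<le> y s - r / 5 * s"
    proof (rule DERIV_nonneg_imp_nondecreasing[OF s(1)])
      fix v assume v: "0 \<le> v" "v \<le> s"
      have "((\<lambda>t. y t - r / 5 * t) has_real_derivative
          sin (x v) + r\<^sup>2 * cos (z v) - r / 5) (at v)"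
        by (auto intro!: derivative_eq_intros abc_solutionD[OF sol])
      moreover have "sin (x v) + r\<^sup>2 * cos (z v) - r / 5 \<ge> 0"
        using speed(3)[of s v] s v T reg by simp
      ultimately show "\<exists>d. ((\<lambda>t. y t - r / 5 * t) has_real_derivative d) (at v) \<and> 0 \<le> d"
        by blast
    qed
    then show ?thesis by simp
  qed
  \<comment> \<open>The three barriers x = 0, x = pi and y = 0; the fourth side, y = pi, is covered
    by the assumption on \<open>y\<close>.\<close>
  define m where "m t = min (min (x t) (pi - x t)) (y t)" for t
  have "m s > 0" if s: "0 \<le> s" "s \<le> T" for s
  proof (rule nonneg_imp_pos_bootstrap[OF _ _ _ s])
    show "continuous_on {0..T} m"
      unfolding m_def by (intro continuous_intros abc_solution_continuous[OF sol])
    show "m 0 > 0" using x0 y0 by (simp add: m_def)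
    fix s assume s: "0 \<le> s" "s \<le> T" and "\<And>v. \<lbrakk>0 \<le> v; v \<le> s\<rbrakk> \<Longrightarrow> m v \<ge> 0"
    then have reg: "0 \<le> x v \<and> x v \<le> pi \<and> 0 \<le> y v \<and> y v \<le> pi" if "0 \<le> v" "v \<le> s" for v
      using y[of v] that by (force simp: m_def)
    have "0 < x s" "x s < pi"
      using speed[of s s] reg s T by auto
    moreover have "y s > 0"
    proof -
      have "r / 5 * s \<ge> 0" using r s by simp
      then show ?thesis using growth[OF s reg] y0 by linarith
    qed
    ultimately show "m s > 0" by (simp add: m_def)
  qed
  then have reg: "0 \<le> x v \<and> x v \<le> pi \<and> 0 \<le> y v \<and> y v \<le> pi" if "0 \<le> v" "v \<le> T" for v
    using that y[of v] by (force simp: m_def)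
  show "0 < x t" "x t < pi" "r / 5 \<le> sin (x t) + r\<^sup>2 * cos (z t)"
    using speed[OF T reg t] by auto
  show "y 0 + r / 5 * t \<le> y t"
    using growth[OF t] reg t by auto
qed

text \<open>While y stays below pi it grows at rate at least r/5, so within time 16/r it would gain
  16/5, more than pi. At y = pi the energy equals cos x, whose sign tells the side of pi/2; the last
  two alternatives read it off from the predicted energy at (pi/2, pi), with margin 1/10 against the
  error 1/20.\<close>

lemma crossing:
  obtains \<tau> where "0 < \<tau>" "\<tau> \<le> 16 / r" "y \<tau> = pi" "\<And>t. \<lbrakk>0 \<le> t; t < \<tau>\<rbrakk> \<Longrightarrow> y t < pi"
    "sin (x \<tau>) + r\<^sup>2 * cos (z \<tau>) > 0"
    "h + (pi / 2 - x 0) * cos (z 0) - (pi - y 0) * sin (z 0) \<ge> 1 / 10 \<Longrightarrow> x \<tau> < pi / 2"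
    "h + (pi / 2 - x 0) * cos (z 0) - (pi - y 0) * sin (z 0) \<le> - 1 / 10 \<Longrightarrow> x \<tau> > pi / 2"
proof -
  define m where "m t = pi - y t" for t
  have cont: "continuous_on S m" for S
    unfolding m_def by (intro continuous_intros abc_solution_continuous[OF sol])
  define T where "T = 16 / r"
  have T: "T > 0" using r by (simp add: T_def)
  have "\<exists>t\<in>{0..T}. y t \<ge> pi"
  proof (rule ccontr)
    assume "\<not> (\<exists>t\<in>{0..T}. y t \<ge> pi)"
    then have *: "y t < pi" if "0 \<le> t" "t \<le> T" for t
      using that by force
    then have "y 0 + r / 5 * T \<le> y T"
      using T by (intro region(3)[of T]) (auto simp: T_def intro: less_imp_le)
    moreover have "r / 5 * T = 16 / 5" using r by (simp add: T_def)
    ultimately show False using *[of T] T y0 pi_approx by simp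
  qed
  then obtain t1 where t1: "0 \<le> t1" "t1 \<le> T" "m t1 \<le> 0" by (auto simp: m_def)
  moreover have "m 0 > 0" using y0 by (simp add: m_def)
  ultimately obtain \<tau> where \<tau>: "0 < \<tau>" "\<tau> \<le> t1" "m \<tau> = 0"
    and pos: "\<And>s. \<lbrakk>0 \<le> s; s < \<tau>\<rbrakk> \<Longrightarrow> m s > 0"
    using first_zero[OF cont] by metis
  have \<tau>0: "0 \<le> \<tau>" "\<tau> \<le> 16 / r" and y\<tau>: "y \<tau> = pi"
    using \<tau> t1 by (auto simp: m_def T_def)
  have below: "y t < pi" if "0 \<le> t" "t < \<tau>" for t
    using pos[OF that] by (simp add: m_def)
  have le: "y t \<le> pi" if "0 \<le> t" "t \<le> \<tau>" for t
    using below[of t] y\<tau> that by (cases "t = \<tau>") auto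
  have reg: "0 < x t" "x t < pi" "y 0 + r / 5 * t \<le> y t" "r / 5 \<le> sin (x t) + r\<^sup>2 * cos (z t)"
    if "0 \<le> t" "t \<le> \<tau>" for t
    using region[OF \<tau>0 _ that] le by auto
  have "0 < x t \<and> x t < pi \<and> 0 < y t \<and> y t \<le> pi" if "0 \<le> t" "t \<le> \<tau>" for t
  proof -
    have "r / 5 * t \<ge> 0" using r that by simp
    then show ?thesis using reg[OF that] le[OF that] y0 by simp
  qed
  then have est: "\<bar>energy x y \<tau> - r\<^sup>2 * (h + (x \<tau> - x 0) * cos (z 0) - (y \<tau> - y 0) * sin (z 0))\<bar>
      \<le> r\<^sup>2 / 20"
    using \<tau>0 by (intro estimates(3)[of \<tau>]) (auto intro: less_imp_le)
  have en: "energy x y \<tau> = cos (x \<tau>)" by (simp add: energy_def y\<tau>)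
  have x\<tau>: "0 < x \<tau>" "x \<tau> < pi" using reg[of \<tau>] \<tau>0 by auto
  have r2: "r\<^sup>2 > 0" using r by simp
  show thesis
  proof
    show "0 < \<tau>" using \<tau>0 y\<tau> y0 by (cases "\<tau> = 0") auto
    show "sin (x \<tau>) + r\<^sup>2 * cos (z \<tau>) > 0" using reg(4)[of \<tau>] \<tau>0 r by simp
    show "x \<tau> < pi / 2"
      if a: "h + (pi / 2 - x 0) * cos (z 0) - (pi - y 0) * sin (z 0) \<ge> 1 / 10"
    proof (rule ccontr)
      assume c: "\<not> x \<tau> < pi / 2"
      note a
      also have "h + (pi / 2 - x 0) * cos (z 0) - (pi - y 0) * sin (z 0)
          \<le> h + (x \<tau> - x 0) * cos (z 0) - (y \<tau> - y 0) * sin (z 0)"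
        using c trig_z0 y\<tau> by (intro diff_mono add_mono mult_right_mono) auto
      finally have "r\<^sup>2 * (1 / 10) \<le> r\<^sup>2 * (h + (x \<tau> - x 0) * cos (z 0) - (y \<tau> - y 0) * sin (z 0))"
        by (intro mult_left_mono) auto
      then have "cos (x \<tau>) > 0" using est r2 unfolding en by linarith
      moreover have "cos (x \<tau>) \<le> cos (pi / 2)"
        using c x\<tau> by (intro cos_monotone_0_pi_le) auto
      ultimately show False by simp
    qed
    show "x \<tau> > pi / 2"
      if a: "h + (pi / 2 - x 0) * cos (z 0) - (pi - y 0) * sin (z 0) \<le> - 1 / 10"
    proof (rule ccontr)
      assume c: "\<not> x \<tau> > pi / 2"
      have "h + (x \<tau> - x 0) * cos (z 0) - (y \<tau> - y 0) * sin (z 0)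
          \<le> h + (pi / 2 - x 0) * cos (z 0) - (pi - y 0) * sin (z 0)"
        using c trig_z0 y\<tau> by (intro diff_mono add_mono mult_right_mono) auto
      also note a
      finally have "r\<^sup>2 * (h + (x \<tau> - x 0) * cos (z 0) - (y \<tau> - y 0) * sin (z 0)) \<le> r\<^sup>2 * (- 1 / 10)"
        by (intro mult_left_mono) auto
      then have "cos (x \<tau>) < 0" using est r2 unfolding en by linarith
      moreover have "cos (pi / 2) \<le> cos (x \<tau>)"
        using c x\<tau> by (intro cos_monotone_0_pi_le) auto
      ultimately show False by simp
    qed
  qed (use \<tau>0 y\<tau> below in auto)
qed

end

section \<open>Shooting\<close>

text \<open>The crossing is transversal. Just after its crossing time a curve lies above the level,
  so nearby curves have crossed by then; up to any earlier time it stays below by a positive gap, so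
  nearby curves have not crossed yet.\<close>

lemma continuous_on_first_crossing:
  fixes Y :: "'p::topological_space \<Rightarrow> real \<Rightarrow> real"
  assumes unif: "\<And>s d. \<lbrakk>s \<in> S; d > 0\<rbrakk> \<Longrightarrow>
      \<forall>\<^sub>F s' in at s within S. \<forall>t\<in>{0..K}. \<bar>Y s' t - Y s t\<bar> < d"
    and cont: "\<And>s. s \<in> S \<Longrightarrow> continuous_on {0..K} (Y s)"
    and \<tau>: "\<And>s. s \<in> S \<Longrightarrow> 0 < \<tau> s" "\<And>s. s \<in> S \<Longrightarrow> \<tau> s < K" "\<And>s. s \<in> S \<Longrightarrow> Y s (\<tau> s) = c"
    and below: "\<And>s t. \<lbrakk>s \<in> S; 0 \<le> t; t < \<tau> s\<rbrakk> \<Longrightarrow> Y s t < c"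
    and deriv: "\<And>s. s \<in> S \<Longrightarrow> \<exists>D>0. (Y s has_real_derivative D) (at (\<tau> s))"
  shows "continuous_on S \<tau>"
  unfolding continuous_on_def
proof (rule ballI, rule tendstoI)
  have ev: "\<forall>\<^sub>F s' in at s within S. s' \<in> S" for s
    by (simp add: eventually_at_filter)
  fix s and \<eta> :: real
  assume s: "s \<in> S" and \<eta>: "\<eta> > 0"
  obtain D where "D > 0" "(Y s has_real_derivative D) (at (\<tau> s))"
    using deriv[OF s] by blast
  then obtain d where d: "d > 0" "\<And>h. \<lbrakk>0 < h; h < d\<rbrakk> \<Longrightarrow> Y s (\<tau> s) < Y s (\<tau> s + h)"
    using DERIV_pos_inc_right by blast
  define h where "h = min (min (d / 2) (\<eta> / 2)) ((K - \<tau> s) / 2)"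
  have h: "0 < h" "h < d" "h < \<eta>" "\<tau> s + h < K"
    using d \<eta> \<tau>(2)[OF s] by (auto simp: h_def min_def field_simps)
  have above: "Y s (\<tau> s + h) - c > 0"
    using d(2)[of h] h \<tau>(3)[OF s] by simp
  have upper: "\<forall>\<^sub>F s' in at s within S. \<tau> s' < \<tau> s + \<eta>"
    using unif[OF s above] ev[of s]
  proof eventually_elim
    case (elim s')
    have "\<tau> s + h \<in> {0..K}" using h \<tau>(1)[OF s] by auto
    then have "Y s' (\<tau> s + h) > c" using elim(1) by force
    then have "\<tau> s' \<le> \<tau> s + h"
      using below[of s' "\<tau> s + h"] elim(2) h \<tau>(1)[OF s] by force
    then show ?case using h by simp
  qed
  have lower: "\<forall>\<^sub>F s' in at s within S. \<tau> s' > \<tau> s - \<eta>"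
  proof (cases "\<tau> s - \<eta> < 0")
    case True
    show ?thesis
      using ev[of s]
    proof eventually_elim
      case (elim s')
      then show ?case using \<tau>(1)[of s'] True by linarith
    qed
  next
    case False
    have "continuous_on {0..\<tau> s - \<eta>} (Y s)"
      using cont[OF s] by (rule continuous_on_subset) (use \<tau>(2)[OF s] \<eta> in auto)
    then obtain u where u: "u \<in> {0..\<tau> s - \<eta>}" "\<And>t. t \<in> {0..\<tau> s - \<eta>} \<Longrightarrow> Y s t \<le> Y s u"
      using continuous_attains_sup[of "{0..\<tau> s - \<eta>}" "Y s"] False by auto
    then have "c - Y s u > 0" using below[OF s, of u] \<eta> by simp
    from unif[OF s this] ev[of s] show ?thesis
    proof eventually_elim
      case (elim s')
      show ?case
      proof (rule ccontr)
        assume n: "\<not> \<tau> s - \<eta> < \<tau> s'"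
        have "\<tau> s' \<in> {0..K}" using elim(2) \<tau>(1,2)[of s'] by simp
        moreover have "Y s (\<tau> s') \<le> Y s u"
          using u(2)[of "\<tau> s'"] n \<tau>(1)[of s'] elim(2) by simp
        ultimately show False using elim \<tau>(3)[of s'] by force
      qed
    qed
  qed
  show "\<forall>\<^sub>F s' in at s within S. dist (\<tau> s') (\<tau> s) < \<eta>"
    using upper lower by eventually_elim (auto simp: dist_real_def)
qed

text \<open>The crossing time is continuous in the parameter, hence so is the x-coordinate at the
  crossing. It lies above \<open>v\<close> at the left end and below \<open>v\<close> at the right
  end, so it takes the value \<open>v\<close> in between.\<close>

lemma abc_shooting:
  fixes P Q R :: "real \<Rightarrow> real"
  assumes e: "\<bar>e\<bar> \<le> 1" and ab: "a \<le> b"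
    and cont: "continuous_on {a..b} P" "continuous_on {a..b} Q" "continuous_on {a..b} R"
    and crossing: "\<And>s x y z. \<lbrakk>a \<le> s; s \<le> b; abc_solution e x y z; x 0 = P s; y 0 = Q s; z 0 = R s\<rbrakk>
      \<Longrightarrow> \<exists>\<tau>. 0 < \<tau> \<and> \<tau> < K \<and> y \<tau> = c \<and> (\<forall>t. 0 \<le> t \<and> t < \<tau> \<longrightarrow> y t < c) \<and>
        sin (x \<tau>) + e * cos (z \<tau>) > 0 \<and> (s = a \<longrightarrow> x \<tau> > v) \<and> (s = b \<longrightarrow> x \<tau> < v)"
  obtains s x y z \<tau> where "a \<le> s" "s \<le> b" "abc_solution e x y z" "x 0 = P s" "y 0 = Q s" "z 0 = R s"
    "0 < \<tau>" "x \<tau> = v" "y \<tau> = c"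
proof -
  have "\<exists>x y z. abc_solution e x y z \<and> x 0 = P s \<and> y 0 = Q s \<and> z 0 = R s" for s
    using abc_solution_exists[OF e, of "P s" "Q s" "R s"] by metis
  then obtain X Y Z where sol: "\<And>s. abc_solution e (X s) (Y s) (Z s)"
    and init: "\<And>s. X s 0 = P s" "\<And>s. Y s 0 = Q s" "\<And>s. Z s 0 = R s"
    by metis
  define S where "S = {a..b}"
  have "\<exists>\<tau>. s \<in> S \<longrightarrow> 0 < \<tau> \<and> \<tau> < K \<and> Y s \<tau> = c \<and> (\<forall>t. 0 \<le> t \<and> t < \<tau> \<longrightarrow> Y s t < c) \<and>
        sin (X s \<tau>) + e * cos (Z s \<tau>) > 0 \<and> (s = a \<longrightarrow> X s \<tau> > v) \<and> (s = b \<longrightarrow> X s \<tau> < v)" for s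
    using crossing[OF _ _ sol[of s] init] by (auto simp: S_def)
  then obtain \<tau> where \<tau>: "\<And>s. s \<in> S \<Longrightarrow> 0 < \<tau> s \<and> \<tau> s < K \<and> Y s (\<tau> s) = c \<and>
        (\<forall>t. 0 \<le> t \<and> t < \<tau> s \<longrightarrow> Y s t < c) \<and> sin (X s (\<tau> s)) + e * cos (Z s (\<tau> s)) > 0 \<and>
        (s = a \<longrightarrow> X s (\<tau> s) > v) \<and> (s = b \<longrightarrow> X s (\<tau> s) < v)"
    by metis
  have ev: "\<forall>\<^sub>F s' in at s within S. s' \<in> S" for s
    by (simp add: eventually_at_filter)
  \<comment> \<open>A bound, uniform over times in [0, K], for the distance between the trajectories
    with parameters s and s'; it tends to 0 as s' tends to s.\<close>
  define \<delta> where "\<delta> s s' = exp (6 * K) * (\<bar>P s' - P s\<bar> + \<bar>Q s' - Q s\<bar> + \<bar>R s' - R s\<bar>)" for s s'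
  have \<delta>_tendsto: "((\<lambda>s'. \<delta> s s') \<longlongrightarrow> 0) (at s within S)" if "s \<in> S" for s
  proof -
    have "((\<lambda>s'. \<delta> s s') \<longlongrightarrow> exp (6 * K) * (\<bar>P s - P s\<bar> + \<bar>Q s - Q s\<bar> + \<bar>R s - R s\<bar>)) (at s within S)"
      unfolding \<delta>_def using cont that unfolding continuous_on_def S_def by (intro tendsto_intros) auto
    then show ?thesis by simp
  qed
  have close: "\<bar>X s' t - X s t\<bar> \<le> \<delta> s s'" "\<bar>Y s' t - Y s t\<bar> \<le> \<delta> s s'" if "t \<in> {0..K}" for s s' t
  proof -
    have "exp (6 * \<bar>t\<bar>) * (\<bar>P s' - P s\<bar> + \<bar>Q s' - Q s\<bar> + \<bar>R s' - R s\<bar>) \<le> \<delta> s s'"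
      unfolding \<delta>_def using that by (intro mult_right_mono) auto
    with abc_solution_dependence[OF e sol[of s'] sol[of s], of t]
    show "\<bar>X s' t - X s t\<bar> \<le> \<delta> s s'" "\<bar>Y s' t - Y s t\<bar> \<le> \<delta> s s'"
      by (simp_all add: init)
  qed
  have cont_\<tau>: "continuous_on S \<tau>"
  proof (rule continuous_on_first_crossing[where Y = Y and K = K and c = c])
    show "\<forall>\<^sub>F s' in at s within S. \<forall>t\<in>{0..K}. \<bar>Y s' t - Y s t\<bar> < d" if "s \<in> S" "d > 0" for s d
      using order_tendstoD(2)[OF \<delta>_tendsto[OF that(1)] that(2)]
    proof eventually_elim
      case (elim s')
      show ?case
      proof
        fix t assume "t \<in> {0..K}"
        from close(2)[OF this] elim show "\<bar>Y s' t - Y s t\<bar> < d" by (rule le_less_trans)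
      qed
    qed
    show "continuous_on {0..K} (Y s)" for s
      by (rule abc_solution_continuous(2)[OF sol])
    show "\<exists>D>0. (Y s has_real_derivative D) (at (\<tau> s))" if "s \<in> S" for s
      by (rule exI, rule conjI[OF _ abc_solutionD(2)[OF sol]]) (simp add: \<tau>[OF that])
  qed (simp_all add: \<tau>)
  have "continuous_on S (\<lambda>s. X s (\<tau> s))"
    unfolding continuous_on_def
  proof
    fix s assume s: "s \<in> S"
    have "((\<lambda>s'. X s (\<tau> s')) \<longlongrightarrow> X s (\<tau> s)) (at s within S)"
      using cont_\<tau> s
      by (intro isCont_tendsto_compose[OF DERIV_isCont[OF abc_solutionD(1)[OF sol]]])
        (simp add: continuous_on_def)
    \<comment> \<open>The change of the crossing position is split: changing only the time is
      handled by continuity of one trajectory, changing the trajectory by the uniform bound.\<close>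
    moreover have "((\<lambda>s'. X s' (\<tau> s') - X s (\<tau> s')) \<longlongrightarrow> 0) (at s within S)"
    proof (rule Lim_null_comparison[OF _ \<delta>_tendsto[OF s]])
      show "\<forall>\<^sub>F s' in at s within S. norm (X s' (\<tau> s') - X s (\<tau> s')) \<le> \<delta> s s'"
        using ev[of s]
      proof eventually_elim
        case (elim s')
        then show ?case using close(1)[of "\<tau> s'" s' s] \<tau>[of s'] by simp
      qed
    qed
    ultimately have "((\<lambda>s'. X s (\<tau> s') + (X s' (\<tau> s') - X s (\<tau> s'))) \<longlongrightarrow> X s (\<tau> s) + 0) (at s within S)"
      by (rule tendsto_add)
    then show "((\<lambda>s'. X s' (\<tau> s')) \<longlongrightarrow> X s (\<tau> s)) (at s within S)" by simp
  qed
  moreover have "X a (\<tau> a) > v" "X b (\<tau> b) < v"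
    using \<tau> ab by (auto simp: S_def)
  ultimately have "\<exists>s\<ge>a. s \<le> b \<and> X s (\<tau> s) = v"
    using ab unfolding S_def by (intro IVT2') auto
  then obtain s where s: "s \<in> S" "X s (\<tau> s) = v" by (auto simp: S_def)
  then show thesis
    using that[OF _ _ sol[of s] init, of "\<tau> s"] \<tau>[OF s(1)] by (auto simp: S_def)
qed

section \<open>Periodic orbits modulo translation\<close>

lemma arcsin_le_double:
  fixes w :: real
  assumes "0 \<le> w" "w \<le> 1 / 2"
  shows "arcsin w \<le> 2 * w"
proof -
  have w: "w\<^sup>2 \<le> 1 / 4" using power_mono[of w "1 / 2" 2] assms by (simp add: power_divide)
  then have sq: "1 / 2 \<le> sqrt (1 - w\<^sup>2)"
    by (intro real_le_rsqrt) (simp add: power_divide)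
  have "arcsin w = arctan (w / sqrt (1 - w\<^sup>2))"
    using assms by (intro arcsin_arctan) auto
  also have "\<dots> \<le> w / sqrt (1 - w\<^sup>2)"
    using assms w by (intro arctan_le_self divide_nonneg_nonneg) auto
  also have "\<dots> \<le> w / (1 / 2)"
    using assms sq w by (intro divide_left_mono) auto
  finally show ?thesis by simp
qed

lemma arcsin_small:
  fixes w :: real
  assumes "0 < w" "w \<le> 1 / 10 ^ 6"
  shows "0 < arcsin w" "arcsin w \<le> 1 / 20"
  using assms arcsin_le_double[of w] arcsin_less_arcsin[of 0 w] by auto

lemma axis_orbit_exists:
  assumes r: "0 < r" "r \<le> 1 / 10 ^ 6"
  obtains x y z \<tau> where "abc_solution (r\<^sup>2) x y z" "0 < \<tau>" "x \<tau> = pi / 2" "y \<tau> = pi"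
    "y 0 = pi / 2" "z 0 = 0"
proof -
  \<comment> \<open>Starting at x = pi - 2w, y = pi/2 the energy is 1 - cos 2w = 2 sin^2 w, and this
    choice of w makes it r^2 h.\<close>
  define w where "w h = arcsin (r * sqrt (h / 2))" for h
  \<comment> \<open>The predicted energy at (pi/2, pi), divided by r^2, is h - pi/2 + 2w with 2w at
    most 1/10. At the ends of \<open>I\<close> it is therefore at most -1/10 and at least
    1/5.\<close>
  define I where "I = {pi / 2 - 1 / 5..pi / 2 + 1 / 5}"
  have sq: "0 < r * sqrt (h / 2)" "r * sqrt (h / 2) \<le> 1 / 10 ^ 6" if "h \<in> I" for h
  proof -
    have "0 < h" "h \<le> 2" using that pi_approx by (auto simp: I_def)
    then show "0 < r * sqrt (h / 2)" using r by simp
    have "r * sqrt (h / 2) \<le> r * 1"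
      using r \<open>h \<le> 2\<close> by (intro mult_left_mono) auto
    then show "r * sqrt (h / 2) \<le> 1 / 10 ^ 6" using r by linarith
  qed
  have w: "0 < w h" "w h \<le> 1 / 20" if "h \<in> I" for h
    unfolding w_def by (rule arcsin_small[OF sq[OF that]])+
  have e: "\<bar>r\<^sup>2\<bar> \<le> 1" using r by (simp add: power_le_one)
  have cross: "\<exists>\<tau>. 0 < \<tau> \<and> \<tau> < 17 / r \<and> y \<tau> = pi \<and> (\<forall>t. 0 \<le> t \<and> t < \<tau> \<longrightarrow> y t < pi) \<and>
      sin (x \<tau>) + r\<^sup>2 * cos (z \<tau>) > 0 \<and> (h = pi / 2 - 1 / 5 \<longrightarrow> x \<tau> > pi / 2) \<and>
      (h = pi / 2 + 1 / 5 \<longrightarrow> x \<tau> < pi / 2)"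
    if h: "pi / 2 - 1 / 5 \<le> h" "h \<le> pi / 2 + 1 / 5" and sol: "abc_solution (r\<^sup>2) x y z"
      and init: "x 0 = pi - 2 * w h" "y 0 = pi / 2" "z 0 = 0" for h x y z
  proof -
    have hI: "h \<in> I" using h by (simp add: I_def)
    note wh = w[OF hI] and pi = pi_approx
    have "energy x y 0 = 1 - cos (2 * w h)"
      by (simp add: energy_def init cos_diff)
    also have "\<dots> = 2 * (sin (w h))\<^sup>2"
      by (simp add: cos_double_sin)
    also have "sin (w h) = r * sqrt (h / 2)"
      unfolding w_def using sq[OF hI] by (intro sin_arcsin) auto
    also have "2 * (r * sqrt (h / 2))\<^sup>2 = r\<^sup>2 * h"
      using h pi by (simp add: power_mult_distrib)
    finally have en: "energy x y 0 = r\<^sup>2 * h" .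
    interpret passage r h x y z
      by unfold_locales (use sol r en init wh h pi in auto)
    obtain \<tau> where \<tau>: "0 < \<tau>" "\<tau> \<le> 16 / r" "y \<tau> = pi" "\<And>t. \<lbrakk>0 \<le> t; t < \<tau>\<rbrakk> \<Longrightarrow> y t < pi"
      "sin (x \<tau>) + r\<^sup>2 * cos (z \<tau>) > 0"
      "h + (pi / 2 - x 0) * cos (z 0) - (pi - y 0) * sin (z 0) \<ge> 1 / 10 \<Longrightarrow> x \<tau> < pi / 2"
      "h + (pi / 2 - x 0) * cos (z 0) - (pi - y 0) * sin (z 0) \<le> - 1 / 10 \<Longrightarrow> x \<tau> > pi / 2"
      by (rule crossing) blast
    \<comment> \<open>The shooting lemma requires a strict bound on the crossing time.\<close>
    have "16 / r < 17 / r" using r by (simp add: divide_strict_right_mono)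
    then show ?thesis
      using \<tau> init wh by (intro exI[of _ \<tau>]) auto
  qed
  have "continuous_on I w"
    unfolding w_def
  proof (intro continuous_intros ballI)
    show "- 1 \<le> r * sqrt (h / 2) \<and> r * sqrt (h / 2) \<le> 1" if "h \<in> I" for h
      using sq[OF that] by auto
  qed simp
  then have cont: "continuous_on {pi / 2 - 1 / 5..pi / 2 + 1 / 5} (\<lambda>h. pi - 2 * w h)"
    unfolding I_def by (intro continuous_intros)
  show thesis
  proof (rule abc_shooting[OF e _ cont continuous_on_const continuous_on_const, OF _ cross])
    fix h x y z \<tau>
    assume "abc_solution (r\<^sup>2) x y z" "0 < \<tau>" "x \<tau> = pi / 2" "y \<tau> = pi" "y 0 = pi / 2" "z 0 = 0"
    then show thesis by (rule that)
  qed simp_all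
qed

lemma diagonal_orbit_exists:
  assumes r: "0 < r" "r \<le> 1 / 10 ^ 6"
  obtains x y z \<tau> where "abc_solution (r\<^sup>2) x y z" "0 < \<tau>" "x \<tau> = pi / 2" "y \<tau> = pi"
    "x 0 + y 0 = pi / 2" "z 0 = pi / 4"
proof -
  define c :: real where "c = sqrt 2 / 2"
  have "7 / 5 \<le> sqrt 2" "sqrt 2 \<le> 71 / 50"
    by (rule real_le_rsqrt real_le_lsqrt; simp add: power_divide)+
  then have c: "7 / 10 \<le> c" "c \<le> 71 / 100"
    by (simp_all add: c_def)
  have pc: "2 \<le> pi * c" "pi * c \<le> 23 / 10"
    using mult_mono[OF pi_approx(1) c(1)] mult_mono[OF pi_approx(2) c(2)] c by simp_all
  \<comment> \<open>Starting at x = pi/2 - w, y = w the energy is 2 sin w, and this choice of w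
    makes it r^2 h.\<close>
  define w where "w h = arcsin (r\<^sup>2 * h / 2)" for h
  \<comment> \<open>With cos z(0) = sin z(0) = c the predicted energy at (pi/2, pi), divided by r^2,
    is h - pi c + 2wc. The last term is below 1/10, so the sign changes between the ends of
    \<open>I\<close>. For \<open>far\<close> the value at x = 2pi/3 is larger by pi c / 6, at least
    1/3, which outweighs the 1/5.\<close>
  define I where "I = {pi * c - 1 / 5..pi * c + 1 / 5}"
  have r2: "0 < r\<^sup>2" "r\<^sup>2 \<le> 1 / 10 ^ 12"
    using r power_mono[of r "1 / 10 ^ 6" 2] by (auto simp: power_divide)
  have sq: "0 < r\<^sup>2 * h / 2" "r\<^sup>2 * h / 2 \<le> 1 / 10 ^ 6" if "h \<in> I" for h
  proof -
    have h: "0 < h" "h \<le> 3" using that pc by (auto simp: I_def)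
    then show "0 < r\<^sup>2 * h / 2" using r by simp
    show "r\<^sup>2 * h / 2 \<le> 1 / 10 ^ 6"
      using mult_mono[OF r2(2) h(2)] h by (simp add: mult.commute)
  qed
  have w: "0 < w h" "w h \<le> 1 / 20" if "h \<in> I" for h
    unfolding w_def by (rule arcsin_small[OF sq[OF that]])+
  have e: "\<bar>r\<^sup>2\<bar> \<le> 1" using r2 by simp
  have cross: "\<exists>\<tau>. 0 < \<tau> \<and> \<tau> < 17 / r \<and> y \<tau> = pi \<and> (\<forall>t. 0 \<le> t \<and> t < \<tau> \<longrightarrow> y t < pi) \<and>
      sin (x \<tau>) + r\<^sup>2 * cos (z \<tau>) > 0 \<and> (h = pi * c - 1 / 5 \<longrightarrow> x \<tau> > pi / 2) \<and>
      (h = pi * c + 1 / 5 \<longrightarrow> x \<tau> < pi / 2)"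
    if h: "pi * c - 1 / 5 \<le> h" "h \<le> pi * c + 1 / 5" and sol: "abc_solution (r\<^sup>2) x y z"
      and init: "x 0 = pi / 2 - w h" "y 0 = w h" "z 0 = pi / 4" for h x y z
  proof -
    have hI: "h \<in> I" using h by (simp add: I_def)
    note wh = w[OF hI] and pi = pi_approx
    have "energy x y 0 = 2 * sin (w h)"
      by (simp add: energy_def init cos_diff)
    also have "sin (w h) = r\<^sup>2 * h / 2"
      unfolding w_def
    proof (rule sin_arcsin)
      show "- 1 \<le> r\<^sup>2 * h / 2" using sq(1)[OF hI] by linarith
      show "r\<^sup>2 * h / 2 \<le> 1" using sq(2)[OF hI] by (rule order_trans) simp
    qed
    finally have en: "energy x y 0 = r\<^sup>2 * h" by simp
    have trig: "cos (z 0) = c" "sin (z 0) = c"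
      by (simp_all add: init c_def cos_45 sin_45)
    have wc: "0 \<le> w h * c" "w h * c \<le> 71 / 2000"
      using mult_mono[OF wh(2) c(2)] wh c by simp_all
    interpret passage r h x y z
    proof unfold_locales
      show "h + (2 * pi / 3 - x 0) * cos (z 0) - (pi - y 0) * sin (z 0) \<ge> 1 / 10"
        unfolding trig unfolding init using h wc pc by (simp add: algebra_simps)
    qed (use sol r en init wh h pi pc in auto)
    obtain \<tau> where \<tau>: "0 < \<tau>" "\<tau> \<le> 16 / r" "y \<tau> = pi" "\<And>t. \<lbrakk>0 \<le> t; t < \<tau>\<rbrakk> \<Longrightarrow> y t < pi"
      "sin (x \<tau>) + r\<^sup>2 * cos (z \<tau>) > 0"
      "h + (pi / 2 - x 0) * cos (z 0) - (pi - y 0) * sin (z 0) \<ge> 1 / 10 \<Longrightarrow> x \<tau> < pi / 2"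
      "h + (pi / 2 - x 0) * cos (z 0) - (pi - y 0) * sin (z 0) \<le> - 1 / 10 \<Longrightarrow> x \<tau> > pi / 2"
      by (rule crossing) blast
    have "16 / r < 17 / r" using r by (simp add: divide_strict_right_mono)
    moreover have "h + (pi / 2 - x 0) * cos (z 0) - (pi - y 0) * sin (z 0) = h - pi * c + 2 * (w h * c)"
      unfolding trig unfolding init by (simp add: algebra_simps)
    ultimately show ?thesis
      using \<tau> wc by (intro exI[of _ \<tau>]) auto
  qed
  have "continuous_on I w"
    unfolding w_def
  proof (intro continuous_intros ballI)
    show "- 1 \<le> r\<^sup>2 * h / 2 \<and> r\<^sup>2 * h / 2 \<le> 1" if "h \<in> I" for h
      using sq(1)[OF that] order_trans[OF sq(2)[OF that], of 1] by simp
  qed simp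
  then have *: "continuous_on {pi * c - 1 / 5..pi * c + 1 / 5} w" by (simp add: I_def)
  then have **: "continuous_on {pi * c - 1 / 5..pi * c + 1 / 5} (\<lambda>h. pi / 2 - w h)"
    by (intro continuous_intros)
  show thesis
  proof (rule abc_shooting[OF e _ ** * continuous_on_const, OF _ cross])
    fix h x y z \<tau>
    assume "abc_solution (r\<^sup>2) x y z" "0 < \<tau>" "x \<tau> = pi / 2" "y \<tau> = pi"
      "x 0 = pi / 2 - w h" "y 0 = w h" "z 0 = pi / 4"
    then show thesis by (intro that[of x y z \<tau>]) simp_all
  qed simp_all
qed

theorem theorem3p1:
  shows "\<forall>\<^sub>F \<epsilon> :: real in at_right 0.
    (\<exists>T>0. \<exists>X1 X2 X3 X4 :: real \<Rightarrow> real^3.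
       abc_trajectory \<epsilon> 1 1 X1 \<and> (\<forall>t. X1 (t + T) = X1 t + vector [2 * pi, 2 * pi, 0]) \<and>
       abc_trajectory \<epsilon> 1 1 X2 \<and> (\<forall>t. X2 (t + T) = X2 t - vector [2 * pi, 2 * pi, 0]) \<and>
       abc_trajectory \<epsilon> 1 1 X3 \<and> (\<forall>t. X3 (t + T) = X3 t + vector [2 * pi, - 2 * pi, 0]) \<and>
       abc_trajectory \<epsilon> 1 1 X4 \<and> (\<forall>t. X4 (t + T) = X4 t - vector [2 * pi, - 2 * pi, 0])) \<and>
    (\<exists>T>0. \<exists>X1 X2 X3 X4 :: real \<Rightarrow> real^3.
       abc_trajectory \<epsilon> 1 1 X1 \<and> (\<forall>t. X1 (t + T) = X1 t + vector [2 * pi, 0, 0]) \<and>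
       abc_trajectory \<epsilon> 1 1 X2 \<and> (\<forall>t. X2 (t + T) = X2 t - vector [2 * pi, 0, 0]) \<and>
       abc_trajectory \<epsilon> 1 1 X3 \<and> (\<forall>t. X3 (t + T) = X3 t + vector [0, 2 * pi, 0]) \<and>
       abc_trajectory \<epsilon> 1 1 X4 \<and> (\<forall>t. X4 (t + T) = X4 t - vector [0, 2 * pi, 0]))"
    (is "\<forall>\<^sub>F \<epsilon> in at_right 0. ?diagonal \<epsilon> \<and> ?axis \<epsilon>")
proof (rule eventually_at_rightI[of 0 "1 / 10 ^ 12"])
  fix \<epsilon> :: real
  assume "\<epsilon> \<in> {0<..<1 / 10 ^ 12}"
  then have \<epsilon>: "0 < \<epsilon>" "\<epsilon> \<le> (1 / 10 ^ 6)\<^sup>2" by (simp_all add: power_divide)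
  define r where "r = sqrt \<epsilon>"
  have r: "0 < r" "r \<le> 1 / 10 ^ 6" "r\<^sup>2 = \<epsilon>"
    using \<epsilon> real_le_lsqrt[OF _ \<epsilon>(2)] by (auto simp: r_def)
  have e: "\<bar>\<epsilon>\<bar> \<le> 1" using \<epsilon> by (simp add: power_divide)
  have "?diagonal \<epsilon>"
  proof -
    obtain x y z \<tau> where sol: "abc_solution \<epsilon> x y z" and "0 < \<tau>"
      and *: "x \<tau> = pi / 2" "y \<tau> = pi" "x 0 + y 0 = pi / 2" "z 0 = pi / 4"
      using diagonal_orbit_exists[OF r(1,2)] r(3) by metis
    define T where "T = 4 * \<tau>"
    have T: "T > 0" using \<open>0 < \<tau>\<close> by (simp add: T_def)
    have per: "x (t + T) = x t + 2 * pi" "y (t + T) = y t + 2 * pi" "z (t + T) = z t" for t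
      unfolding T_def using diagonal_orbit_translation[OF sol e *] by auto
    have per': "x (- t - T) = x (- t) - 2 * pi" "y (- t - T) = y (- t) - 2 * pi"
      "z (- t - T) = z (- t)" for t
      using per[of "- t - T"] by simp_all
    \<comment> \<open>Composing two reversals restores the direction of time: x advances as before,
      while y is negated, so its shift changes sign.\<close>
    have sol': "abc_solution \<epsilon> (\<lambda>t. pi + x t) (\<lambda>t. pi + (pi - y t)) (\<lambda>t. pi + - z t)"
      using reversal_111[OF reversal_100[OF sol]] by simp
    have "\<exists>X. abc_trajectory \<epsilon> 1 1 X \<and> (\<forall>t. X (t + T) = X t + vector [2 * pi, 2 * pi, 0])"
      by (rule translating_trajectory[OF sol]) (simp_all add: per)
    moreover have
      "\<exists>X. abc_trajectory \<epsilon> 1 1 X \<and> (\<forall>t. X (t + T) = X t - vector [2 * pi, 2 * pi, 0])"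
      using translating_trajectory[OF reversal_111[OF sol], of T "- vector [2 * pi, 2 * pi, 0]"]
      by (simp add: per')
    moreover have
      "\<exists>X. abc_trajectory \<epsilon> 1 1 X \<and> (\<forall>t. X (t + T) = X t + vector [2 * pi, - 2 * pi, 0])"
      by (rule translating_trajectory[OF sol']) (simp_all add: per)
    moreover have
      "\<exists>X. abc_trajectory \<epsilon> 1 1 X \<and> (\<forall>t. X (t + T) = X t - vector [2 * pi, - 2 * pi, 0])"
      \<comment> \<open>Time reversal negates the shift of x; the shift of y is negated twice and
        stays.\<close>
      using translating_trajectory[OF reversal_100[OF sol], of T "- vector [2 * pi, - 2 * pi, 0]"]
      by (simp add: per')
    ultimately show ?thesis using T by blast
  qed
  moreover have "?axis \<epsilon>"
  proof -
    obtain x y z \<tau> where sol: "abc_solution \<epsilon> x y z" and "0 < \<tau>"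
      and *: "x \<tau> = pi / 2" "y \<tau> = pi" "y 0 = pi / 2" "z 0 = 0"
      using axis_orbit_exists[OF r(1,2)] r(3) by metis
    define T where "T = 4 * \<tau>"
    have T: "T > 0" using \<open>0 < \<tau>\<close> by (simp add: T_def)
    have per: "x (t + T) = x t" "y (t + T) = y t + 2 * pi" "z (t + T) = z t" for t
      unfolding T_def using axis_orbit_translation[OF sol e *] by auto
    have per': "x (- t - T) = x (- t)" "y (- t - T) = y (- t) - 2 * pi"
      "z (- t - T) = z (- t)" for t
      using per[of "- t - T"] by simp_all
    have "\<exists>X. abc_trajectory \<epsilon> 1 1 X \<and> (\<forall>t. X (t + T) = X t + vector [2 * pi, 0, 0])"
      \<comment> \<open>Exchanging x and y moves the shift from the y-axis to the x-axis with the
        same T.\<close>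
      by (rule translating_trajectory[OF symmetry_swap[OF sol]]) (simp_all add: per)
    moreover have
      "\<exists>X. abc_trajectory \<epsilon> 1 1 X \<and> (\<forall>t. X (t + T) = X t - vector [2 * pi, 0, 0])"
      using translating_trajectory[OF reversal_111[OF symmetry_swap[OF sol]], of T
          "- vector [2 * pi, 0, 0]"]
      by (simp add: per')
    moreover have
      "\<exists>X. abc_trajectory \<epsilon> 1 1 X \<and> (\<forall>t. X (t + T) = X t + vector [0, 2 * pi, 0])"
      by (rule translating_trajectory[OF sol]) (simp_all add: per)
    moreover have
      "\<exists>X. abc_trajectory \<epsilon> 1 1 X \<and> (\<forall>t. X (t + T) = X t - vector [0, 2 * pi, 0])"
      using translating_trajectory[OF reversal_111[OF sol], of T "- vector [0, 2 * pi, 0]"]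
      by (simp add: per')
    ultimately show ?thesis using T by blast
  qed
  ultimately show "?diagonal \<epsilon> \<and> ?axis \<epsilon>" ..
qed simp

end
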